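(* Let $(\mathcal{E},\mathcal{J},\mathcal{M})$ be a double factorization system on a bicomplete (respectively, finitely bicomplete) category $\mathcal{C}$, let $\mathbb{T}=(T,\eta,\mu)$ be a monad on $\mathcal{C}$, and suppose that the functor $T$ preserves all small (respectively, finite) colimits, that $T(\mathcal{E})\subseteq\mathcal{E}$ and that $T(\mathcal{J})\subseteq\mathcal{J}$. Let $\mathcal{S}$ denote one of the classes $\mathcal{J}$ or $\mathcal{J}\cdot\mathcal{E}$. Let $F^{\mathbb{T}}\colon\mathcal{C}\leftrightarrows\mathcal{C}^{\mathbb{T}}\colon V^{\mathbb{T}}$ be the free algebra/forgetful adjunction, and put $\mathcal{E}^{\mathbb{T}}=(V^{\mathbb{T}})^{-1}(\mathcal{E})$, $\mathcal{J}^{\mathbb{T}}=(V^{\mathbb{T}})^{-1}(\mathcal{J})$, $\mathcal{M}^{\mathbb{T}}=(V^{\mathbb{T}})^{-1}(\mathcal{M})$, $\mathcal{S}^{\mathbb{T}}=(V^{\mathbb{T}})^{-1}(\mathcal{S})$. Then: (i) $(\mathcal{E}^{\mathbb{T}},\mathcal{J}^{\mathbb{T}},\mathcal{M}^{\mathbb{T}})$ is the right-induced double factorization system on $\mathcal{C}^{\mathbb{T}}$ generated by $V^{\mathbb{T}}$; (ii) $V^{\mathbb{T}}$ preserves and reflects the corresponding local objects: for every $\mathbb{T}$-algebra $(A,h)$, the object $(A,h)$ is $\mathcal{S}^{\mathbb{T}}$-local in $\mathcal{C}^{\mathbb{T}}$ if and only if $A$ is $\mathcal{S}$-local in $\mathcal{C}$.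 In particular, $F^{\mathbb{T}}\colon\mathcal{C}\leftrightarrows\mathcal{C}^{\mathbb{T}}\colon V^{\mathbb{T}}$ is a Quillen adjunction.
   Context: For classes of morphisms $\mathcal{A},\mathcal{B}$, $\mathcal{B}\cdot\mathcal{A}$ is the class of all composites $ba$ with $a\in\mathcal{A}$, $b\in\mathcal{B}$. Write $f\perp g$ if every commutative square from $f$ to $g$ has a unique diagonal filler; $\mathcal{A}^{\perp}=\{g: f\perp g\ \forall f\in\mathcal{A}\}$ and ${}^{\perp}\mathcal{A}=\{f: f\perp g\ \forall g\in\mathcal{A}\}$. A double factorization system (dfs) on $\mathcal{C}$ is a triple $(\mathcal{E},\mathcal{J},\mathcal{M})$ of classes of morphisms such that: (1) $\mathrm{Iso}\cdot\mathcal{E}\subseteq\mathcal{E}$, $\mathrm{Iso}\cdot\mathcal{J}\cdot\mathrm{Iso}\subseteq\mathcal{J}$, $\mathcal{M}\cdot\mathrm{Iso}\subseteq\mathcal{M}$; (2) every morphism lies in $\mathcal{M}\cdot\mathcal{J}\cdot\mathcal{E}$; (3) for $e\colon A\to B$ in $\mathcal{E}$, $j\colon B\to C$ and $j'\colon D\to E$ in $\mathcal{J}$, $m\colon E\to F$ in $\mathcal{M}$ and $u\colon A\to D$, $v\colon C\to F$ with $vje=mj'u$, there is a unique pair $s\colon B\to D$, $t\colon C\to E$ with $se=u$, $j's=tj$, $mt=v$. The morphisms in $\mathcal{E}$, $\mathcal{J}$, $\mathcal{M}$, $\mathcal{J}\cdot\mathcal{E}$, $\mathcal{M}\cdot\mathcal{J}$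 are called trivial cofibrations, bifibrant morphisms, trivial fibrations, cofibrations, fibrations respectively. $\mathcal{C}^{\mathbb{T}}$ is the category of Eilenberg–Moore algebras $(A,h\colon TA\to A)$. For a functor $V$ and a class $\mathcal{A}$ of morphisms, $V^{-1}(\mathcal{A})$ is the class of morphisms $f$ with $V(f)\in\mathcal{A}$. Given an adjunction $F\colon\mathcal{C}\rightleftarrows\mathcal{D}\colon G$ ($F$ left adjoint) and a dfs $(\mathcal{E},\mathcal{J},\mathcal{M})$ on $\mathcal{C}$, the triple $({}^{\perp}(G^{-1}(\mathcal{M}\cdot\mathcal{J})),G^{-1}(\mathcal{J}),G^{-1}(\mathcal{M}))$ is called the right-induced dfs if it is a dfs on $\mathcal{D}$. So (i) asserts that $(\mathcal{E}^{\mathbb{T}},\mathcal{J}^{\mathbb{T}},\mathcal{M}^{\mathbb{T}})$ is a dfs and equals this triple for $G=V^{\mathbb{T}}$. For a class $\mathcal{L}$ of morphisms, an object $X$ is $\mathcal{L}$-local if for every $m\colon A\to B$ in $\mathcal{L}$ the map $\mathcal{C}(B,X)\to\mathcal{C}(A,X)$, $g\mapsto gm$, is a bijection. For categories with dfs's $(\mathcal{E}_{\mathcal{C}},\mathcal{J}_{\mathcal{C}},\mathcal{M}_{\mathcal{C}})$ and $(\mathcal{E}_{\mathcal{D}},\mathcal{J}_{\mathcal{D}},\mathcal{M}_{\mathcal{D}})$, an adjunction $F\colon\mathcal{C}\leftrightarrows\mathcal{D}\colon G$ is a Quillen adjunction if $F(\mathcal{J}_{\mathcal{C}}\cdot\mathcal{E}_{\mathcal{C}})\subseteq\mathcal{J}_{\mathcal{D}}\cdot\mathcal{E}_{\mathcal{D}}$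 and $F(\mathcal{E}_{\mathcal{C}})\subseteq\mathcal{E}_{\mathcal{D}}$. Here $\mathcal{C}^{\mathbb{T}}$ carries the dfs of (i). *)

theory Defs
  imports Main "HOL-Library.Equipollence"
begin

section \<open>Categories and functors\<close>

record ('o, 'm) category =
  Obj :: "'o set"
  Arr :: "'m set"
  Dom :: "'m \<Rightarrow> 'o"
  Cod :: "'m \<Rightarrow> 'o"
  Ident :: "'o \<Rightarrow> 'm"
  Comp :: "'m \<Rightarrow> 'm \<Rightarrow> 'm"  (infixr "\<cdot>\<index>" 70)

definition hom :: "('o, 'm) category \<Rightarrow> 'o \<Rightarrow> 'o \<Rightarrow> 'm set" where
  "hom C A B = {f \<in> Arr C. Dom C f = A \<and> Cod C f = B}"

locale category =
  fixes C :: "('o, 'm) category" (structure)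
  assumes dom_in: "f \<in> Arr C \<Longrightarrow> Dom C f \<in> Obj C"
    and cod_in: "f \<in> Arr C \<Longrightarrow> Cod C f \<in> Obj C"
    and ident_in: "A \<in> Obj C \<Longrightarrow> Ident C A \<in> hom C A A"
    and comp_in: "f \<in> hom C X Y \<Longrightarrow> g \<in> hom C Y Z \<Longrightarrow> g \<cdot> f \<in> hom C X Z"
    and comp_ident: "f \<in> hom C X Y \<Longrightarrow> f \<cdot> Ident C X = f"
    and ident_comp: "f \<in> hom C X Y \<Longrightarrow> Ident C Y \<cdot> f = f"
    and comp_assoc: "f \<in> hom C X Y \<Longrightarrow> g \<in> hom C Y Z \<Longrightarrow> h \<in> hom C Z W
      \<Longrightarrow> (h \<cdot> g) \<cdot> f = h \<cdot> (g \<cdot> f)"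

record ('o1, 'm1, 'o2, 'm2) fctr =
  ob :: "'o1 \<Rightarrow> 'o2"
  ar :: "'m1 \<Rightarrow> 'm2"

definition fcomp ::
  "('o2, 'm2, 'o3, 'm3) fctr \<Rightarrow> ('o1, 'm1, 'o2, 'm2) fctr \<Rightarrow> ('o1, 'm1, 'o3, 'm3) fctr" where
  "fcomp G F = \<lparr>ob = ob G \<circ> ob F, ar = ar G \<circ> ar F\<rparr>"

definition fident :: "('o, 'm, 'o, 'm) fctr" where
  "fident = \<lparr>ob = id, ar = id\<rparr>"

locale category_functor =
  dom_cat: category C + cod_cat: category D
  for C :: "('o1, 'm1) category" and D :: "('o2, 'm2) category" +
  fixes F :: "('o1, 'm1, 'o2, 'm2) fctr"
  assumes ob_in: "A \<in> Obj C \<Longrightarrow> ob F A \<in> Obj D"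
    and ar_in: "f \<in> hom C A B \<Longrightarrow> ar F f \<in> hom D (ob F A) (ob F B)"
    and ar_ident: "A \<in> Obj C \<Longrightarrow> ar F (Ident C A) = Ident D (ob F A)"
    and ar_comp: "f \<in> hom C X Y \<Longrightarrow> g \<in> hom C Y Z
      \<Longrightarrow> ar F (g \<cdot>\<^bsub>C\<^esub> f) = ar F g \<cdot>\<^bsub>D\<^esub> ar F f"

locale nat_transformation =
  source: category_functor C D F + target: category_functor C D G
  for C :: "('o1, 'm1) category" and D :: "('o2, 'm2) category"
    and F G :: "('o1, 'm1, 'o2, 'm2) fctr" +
  fixes \<tau> :: "'o1 \<Rightarrow> 'm2"
  assumes component_in: "A \<in> Obj C \<Longrightarrow> \<tau> A \<in> hom D (ob F A) (ob G A)"
    and natural: "f \<in> hom C A B \<Longrightarrow> \<tau> B \<cdot>\<^bsub>D\<^esub> ar F f = ar G f \<cdot>\<^bsub>D\<^esub> \<tau> A"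

locale adjunction =
  unit: nat_transformation C C fident "fcomp G F" \<eta> +
  counit: nat_transformation D D "fcomp F G" fident \<epsilon> +
  left: category_functor C D F + right: category_functor D C G
  for C :: "('o1, 'm1) category" and D :: "('o2, 'm2) category"
    and F :: "('o1, 'm1, 'o2, 'm2) fctr" and G :: "('o2, 'm2, 'o1, 'm1) fctr"
    and \<eta> :: "'o1 \<Rightarrow> 'm1" and \<epsilon> :: "'o2 \<Rightarrow> 'm2" +
  assumes triangle_left: "A \<in> Obj C \<Longrightarrow> \<epsilon> (ob F A) \<cdot>\<^bsub>D\<^esub> ar F (\<eta> A) = Ident D (ob F A)"
    and triangle_right: "X \<in> Obj D \<Longrightarrow> ar G (\<epsilon> X) \<cdot>\<^bsub>C\<^esub> \<eta> (ob G X) = Ident C (ob G X)"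


section \<open>Limits and colimits\<close>

definition is_cone :: "('i, 'j) category \<Rightarrow> ('o, 'm) category \<Rightarrow> ('i, 'j, 'o, 'm) fctr
    \<Rightarrow> 'o \<Rightarrow> ('i \<Rightarrow> 'm) \<Rightarrow> bool" where
  "is_cone I C D X \<pi> \<longleftrightarrow> X \<in> Obj C \<and> (\<forall>i\<in>Obj I. \<pi> i \<in> hom C X (ob D i)) \<and>
    (\<forall>f\<in>Arr I. ar D f \<cdot>\<^bsub>C\<^esub> \<pi> (Dom I f) = \<pi> (Cod I f))"

definition is_limit :: "('i, 'j) category \<Rightarrow> ('o, 'm) category \<Rightarrow> ('i, 'j, 'o, 'm) fctr
    \<Rightarrow> 'o \<Rightarrow> ('i \<Rightarrow> 'm) \<Rightarrow> bool" where
  "is_limit I C D X \<pi> \<longleftrightarrow> is_cone I C D X \<pi> \<and>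
    (\<forall>Y \<tau>. is_cone I C D Y \<tau> \<longrightarrow> (\<exists>!u. u \<in> hom C Y X \<and> (\<forall>i\<in>Obj I. \<pi> i \<cdot>\<^bsub>C\<^esub> u = \<tau> i)))"

definition is_cocone :: "('i, 'j) category \<Rightarrow> ('o, 'm) category \<Rightarrow> ('i, 'j, 'o, 'm) fctr
    \<Rightarrow> 'o \<Rightarrow> ('i \<Rightarrow> 'm) \<Rightarrow> bool" where
  "is_cocone I C D X \<iota> \<longleftrightarrow> X \<in> Obj C \<and> (\<forall>i\<in>Obj I. \<iota> i \<in> hom C (ob D i) X) \<and>
    (\<forall>f\<in>Arr I. \<iota> (Cod I f) \<cdot>\<^bsub>C\<^esub> ar D f = \<iota> (Dom I f))"

definition is_colimit :: "('i, 'j) category \<Rightarrow> ('o, 'm) category \<Rightarrow> ('i, 'j, 'o, 'm) fctr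
    \<Rightarrow> 'o \<Rightarrow> ('i \<Rightarrow> 'm) \<Rightarrow> bool" where
  "is_colimit I C D X \<iota> \<longleftrightarrow> is_cocone I C D X \<iota> \<and>
    (\<forall>Y \<tau>. is_cocone I C D Y \<tau> \<longrightarrow> (\<exists>!u. u \<in> hom C X Y \<and> (\<forall>i\<in>Obj I. u \<cdot>\<^bsub>C\<^esub> \<iota> i = \<tau> i)))"

definition has_limits_of_shape :: "('i, 'j) category \<Rightarrow> ('o, 'm) category \<Rightarrow> bool" where
  "has_limits_of_shape I C \<longleftrightarrow>
    (\<forall>D. category_functor I C D \<longrightarrow> (\<exists>X \<pi>. is_limit I C D X \<pi>))"

definition has_colimits_of_shape :: "('i, 'j) category \<Rightarrow> ('o, 'm) category \<Rightarrow> bool" where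
  "has_colimits_of_shape I C \<longleftrightarrow>
    (\<forall>D. category_functor I C D \<longrightarrow> (\<exists>X \<iota>. is_colimit I C D X \<iota>))"

definition preserves_colimits_of_shape :: "('i, 'j) category \<Rightarrow> ('o1, 'm1) category
    \<Rightarrow> ('o2, 'm2) category \<Rightarrow> ('o1, 'm1, 'o2, 'm2) fctr \<Rightarrow> bool" where
  "preserves_colimits_of_shape I C C' T \<longleftrightarrow>
    (\<forall>D X \<iota>. category_functor I C D \<and> is_colimit I C D X \<iota> \<longrightarrow>
      is_colimit I C' (fcomp T D) (ob T X) (\<lambda>i. ar T (\<iota> i)))"

text \<open>
  Smallness is relative to a type \<open>'u\<close> playing the role of the universe: a set is small if its
  cardinality is strictly less than that of \<open>'u\<close>. If \<open>'u\<close> has the cardinality of a Grothendieck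
  universe, these are, up to bijection, exactly the elements of that universe, and every small
  category is isomorphic to one whose objects and arrows are taken from \<open>'u\<close>. The types of objects
  and arrows of the category \<open>C\<close> below are unrelated to \<open>'u\<close>, so \<open>C\<close> may be large.
\<close>

definition small_category :: "('u, 'u) category \<Rightarrow> bool" where
  "small_category I \<longleftrightarrow> category I \<and>
    Obj I \<prec> (UNIV :: 'u set) \<and> Arr I \<prec> (UNIV :: 'u set)"

definition bicomplete :: "'u itself \<Rightarrow> ('o, 'm) category \<Rightarrow> bool" where
  "bicomplete (U :: 'u itself) C \<longleftrightarrow> (\<forall>I :: ('u, 'u) category. small_category I \<longrightarrow>
    has_limits_of_shape I C \<and> has_colimits_of_shape I C)"

definition preserves_small_colimits :: "'u itself \<Rightarrow> ('o1, 'm1) category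
    \<Rightarrow> ('o2, 'm2) category \<Rightarrow> ('o1, 'm1, 'o2, 'm2) fctr \<Rightarrow> bool" where
  "preserves_small_colimits (U :: 'u itself) C C' T \<longleftrightarrow>
    (\<forall>I :: ('u, 'u) category. small_category I \<longrightarrow> preserves_colimits_of_shape I C C' T)"

text \<open>Every finite category is isomorphic to one whose objects and arrows are natural numbers.\<close>

definition finite_category :: "(nat, nat) category \<Rightarrow> bool" where
  "finite_category I \<longleftrightarrow> category I \<and> finite (Obj I) \<and> finite (Arr I)"

definition finitely_bicomplete :: "('o, 'm) category \<Rightarrow> bool" where
  "finitely_bicomplete C \<longleftrightarrow> (\<forall>I. finite_category I \<longrightarrow>
    has_limits_of_shape I C \<and> has_colimits_of_shape I C)"

definition preserves_finite_colimits :: "('o1, 'm1) category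
    \<Rightarrow> ('o2, 'm2) category \<Rightarrow> ('o1, 'm1, 'o2, 'm2) fctr \<Rightarrow> bool" where
  "preserves_finite_colimits C C' T \<longleftrightarrow>
    (\<forall>I. finite_category I \<longrightarrow> preserves_colimits_of_shape I C C' T)"


section \<open>Classes of morphisms\<close>

definition isos :: "('o, 'm) category \<Rightarrow> 'm set" where
  "isos C = {f \<in> Arr C. \<exists>g \<in> hom C (Cod C f) (Dom C f).
    g \<cdot>\<^bsub>C\<^esub> f = Ident C (Dom C f) \<and> f \<cdot>\<^bsub>C\<^esub> g = Ident C (Cod C f)}"

definition composites :: "('o, 'm) category \<Rightarrow> 'm set \<Rightarrow> 'm set \<Rightarrow> 'm set" where
  "composites C \<B> \<A> = {b \<cdot>\<^bsub>C\<^esub> a | a b. a \<in> \<A> \<inter> Arr C \<and> b \<in> \<B> \<inter> Arr C \<and> Cod C a = Dom C b}"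

definition orthogonal :: "('o, 'm) category \<Rightarrow> 'm \<Rightarrow> 'm \<Rightarrow> bool" where
  "orthogonal C f g \<longleftrightarrow>
    (\<forall>u \<in> hom C (Dom C f) (Dom C g). \<forall>v \<in> hom C (Cod C f) (Cod C g).
      v \<cdot>\<^bsub>C\<^esub> f = g \<cdot>\<^bsub>C\<^esub> u \<longrightarrow>
      (\<exists>!d. d \<in> hom C (Cod C f) (Dom C g) \<and> d \<cdot>\<^bsub>C\<^esub> f = u \<and> g \<cdot>\<^bsub>C\<^esub> d = v))"

definition left_orthogonal :: "('o, 'm) category \<Rightarrow> 'm set \<Rightarrow> 'm set" where
  "left_orthogonal C \<A> = {f \<in> Arr C. \<forall>g \<in> \<A>. orthogonal C f g}"

definition preimage_class ::
  "('o1, 'm1) category \<Rightarrow> ('o1, 'm1, 'o2, 'm2) fctr \<Rightarrow> 'm2 set \<Rightarrow> 'm1 set" where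
  "preimage_class D V \<A> = {f \<in> Arr D. ar V f \<in> \<A>}"

definition local_object :: "('o, 'm) category \<Rightarrow> 'm set \<Rightarrow> 'o \<Rightarrow> bool" where
  "local_object C \<L> X \<longleftrightarrow> X \<in> Obj C \<and>
    (\<forall>m \<in> \<L>. bij_betw (\<lambda>g. g \<cdot>\<^bsub>C\<^esub> m) (hom C (Cod C m) X) (hom C (Dom C m) X))"


section \<open>Double factorization systems\<close>

locale double_factorization_system = category C
  for C :: "('o, 'm) category" (structure) +
  fixes \<E> \<J> \<M> :: "'m set"
  assumes E_subset: "\<E> \<subseteq> Arr C" and J_subset: "\<J> \<subseteq> Arr C" and M_subset: "\<M> \<subseteq> Arr C"
    and iso_E: "composites C (isos C) \<E> \<subseteq> \<E>"
    and iso_J_iso: "composites C (isos C) (composites C \<J> (isos C)) \<subseteq> \<J>"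
    and M_iso: "composites C \<M> (isos C) \<subseteq> \<M>"
    and factorization: "Arr C \<subseteq> composites C \<M> (composites C \<J> \<E>)"
    and unique_lifting:
      "e \<in> \<E> \<inter> hom C X1 X2 \<Longrightarrow> j \<in> \<J> \<inter> hom C X2 X3 \<Longrightarrow>
       j' \<in> \<J> \<inter> hom C Y1 Y2 \<Longrightarrow> m \<in> \<M> \<inter> hom C Y2 Y3 \<Longrightarrow>
       u \<in> hom C X1 Y1 \<Longrightarrow> v \<in> hom C X3 Y3 \<Longrightarrow>
       v \<cdot> j \<cdot> e = m \<cdot> j' \<cdot> u \<Longrightarrow>
       \<exists>!(s, t). s \<in> hom C X2 Y1 \<and> t \<in> hom C X3 Y2 \<and>
         s \<cdot> e = u \<and> j' \<cdot> s = t \<cdot> j \<and> m \<cdot> t = v"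

definition right_induced_dfs ::
  "('o1, 'm1) category \<Rightarrow> ('o2, 'm2) category
    \<Rightarrow> ('o1, 'm1, 'o2, 'm2) fctr \<Rightarrow> ('o2, 'm2, 'o1, 'm1) fctr
    \<Rightarrow> ('o1 \<Rightarrow> 'm1) \<Rightarrow> ('o2 \<Rightarrow> 'm2)
    \<Rightarrow> 'm1 set \<times> 'm1 set \<times> 'm1 set \<Rightarrow> 'm2 set \<times> 'm2 set \<times> 'm2 set \<Rightarrow> bool" where
  "right_induced_dfs C D F G \<eta> \<epsilon> = (\<lambda>(\<E>, \<J>, \<M>) (\<E>', \<J>', \<M>').
    adjunction C D F G \<eta> \<epsilon> \<and>
    double_factorization_system C \<E> \<J> \<M> \<and>
    double_factorization_system D \<E>' \<J>' \<M>' \<and>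
    \<E>' = left_orthogonal D (preimage_class D G (composites C \<M> \<J>)) \<and>
    \<J>' = preimage_class D G \<J> \<and>
    \<M>' = preimage_class D G \<M>)"

definition quillen_adjunction ::
  "('o1, 'm1) category \<Rightarrow> ('o2, 'm2) category
    \<Rightarrow> ('o1, 'm1, 'o2, 'm2) fctr \<Rightarrow> ('o2, 'm2, 'o1, 'm1) fctr
    \<Rightarrow> ('o1 \<Rightarrow> 'm1) \<Rightarrow> ('o2 \<Rightarrow> 'm2)
    \<Rightarrow> 'm1 set \<times> 'm1 set \<times> 'm1 set \<Rightarrow> 'm2 set \<times> 'm2 set \<times> 'm2 set \<Rightarrow> bool" where
  "quillen_adjunction C D F G \<eta> \<epsilon> = (\<lambda>(\<E>, \<J>, \<M>) (\<E>', \<J>', \<M>').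
    adjunction C D F G \<eta> \<epsilon> \<and>
    double_factorization_system C \<E> \<J> \<M> \<and>
    double_factorization_system D \<E>' \<J>' \<M>' \<and>
    ar F ` composites C \<J> \<E> \<subseteq> composites D \<J>' \<E>' \<and>
    ar F ` \<E> \<subseteq> \<E>')"


section \<open>Monads and Eilenberg--Moore algebras\<close>

locale monad =
  category_functor C C T +
  unit: nat_transformation C C fident T \<eta> +
  mult: nat_transformation C C "fcomp T T" T \<mu>
  for C :: "('o, 'm) category" (structure) and T :: "('o, 'm, 'o, 'm) fctr"
    and \<eta> \<mu> :: "'o \<Rightarrow> 'm" +
  assumes unit_left: "A \<in> Obj C \<Longrightarrow> \<mu> A \<cdot> \<eta> (ob T A) = Ident C (ob T A)"
    and unit_right: "A \<in> Obj C \<Longrightarrow> \<mu> A \<cdot> ar T (\<eta> A) = Ident C (ob T A)"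
    and mult_assoc: "A \<in> Obj C \<Longrightarrow> \<mu> A \<cdot> \<mu> (ob T A) = \<mu> A \<cdot> ar T (\<mu> A)"

definition em_algebras :: "('o, 'm) category \<Rightarrow> ('o, 'm, 'o, 'm) fctr
    \<Rightarrow> ('o \<Rightarrow> 'm) \<Rightarrow> ('o \<Rightarrow> 'm) \<Rightarrow> ('o \<times> 'm) set" where
  "em_algebras C T \<eta> \<mu> = {(A, h). A \<in> Obj C \<and> h \<in> hom C (ob T A) A \<and>
    h \<cdot>\<^bsub>C\<^esub> \<eta> A = Ident C A \<and> h \<cdot>\<^bsub>C\<^esub> \<mu> A = h \<cdot>\<^bsub>C\<^esub> ar T h}"

text \<open>
  A morphism of algebras is a triple of domain, codomain and underlying morphism, since the
  underlying morphism does not determine the algebra structures.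
\<close>

type_synonym ('o, 'm) em_arr = "('o \<times> 'm) \<times> ('o \<times> 'm) \<times> 'm"

definition em_category :: "('o, 'm) category \<Rightarrow> ('o, 'm, 'o, 'm) fctr
    \<Rightarrow> ('o \<Rightarrow> 'm) \<Rightarrow> ('o \<Rightarrow> 'm) \<Rightarrow> ('o \<times> 'm, ('o, 'm) em_arr) category" where
  "em_category C T \<eta> \<mu> =
    \<lparr>Obj = em_algebras C T \<eta> \<mu>,
     Arr = {((A, h), (B, k), f). (A, h) \<in> em_algebras C T \<eta> \<mu> \<and> (B, k) \<in> em_algebras C T \<eta> \<mu> \<and>
       f \<in> hom C A B \<and> f \<cdot>\<^bsub>C\<^esub> h = k \<cdot>\<^bsub>C\<^esub> ar T f},
     Dom = (\<lambda>(a, b, f). a),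
     Cod = (\<lambda>(a, b, f). b),
     Ident = (\<lambda>(A, h). ((A, h), (A, h), Ident C A)),
     Comp = (\<lambda>(b', c, g) (a, b, f). (a, c, g \<cdot>\<^bsub>C\<^esub> f))\<rparr>"

definition em_forgetful :: "('o \<times> 'm, ('o, 'm) em_arr, 'o, 'm) fctr" where
  "em_forgetful = \<lparr>ob = (\<lambda>(A, h). A), ar = (\<lambda>(a, b, f). f)\<rparr>"

definition em_free :: "('o, 'm) category \<Rightarrow> ('o, 'm, 'o, 'm) fctr \<Rightarrow> ('o \<Rightarrow> 'm)
    \<Rightarrow> ('o, 'm, 'o \<times> 'm, ('o, 'm) em_arr) fctr" where
  "em_free C T \<mu> = \<lparr>ob = (\<lambda>A. (ob T A, \<mu> A)),
     ar = (\<lambda>f. ((ob T (Dom C f), \<mu> (Dom C f)), (ob T (Cod C f), \<mu> (Cod C f)), ar T f))\<rparr>"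

text \<open>The unit of the free/forgetful adjunction is the unit of the monad.\<close>

definition em_counit :: "('o, 'm, 'o, 'm) fctr \<Rightarrow> ('o \<Rightarrow> 'm)
    \<Rightarrow> ('o \<times> 'm) \<Rightarrow> ('o, 'm) em_arr" where
  "em_counit T \<mu> = (\<lambda>(A, h). ((ob T A, \<mu> A), (A, h), h))"

end

theory Submission
  imports Defs
begin

text \<open>
  Lifting a factorization \<open>V f = m j e\<close> to algebras amounts to finding diagonals of the square from
  \<open>(T e, T j)\<close> to \<open>(j, m)\<close>, which exist since \<open>T\<close> preserves \<open>\<E>\<close> and \<open>\<J>\<close>; uniqueness of diagonals
  yields the algebra laws and shows that diagonals of squares of algebra morphisms are algebra
  morphisms. In any double factorization system \<open>\<E> = \<^sup>\<bottom>(\<M> \<cdot> \<J>)\<close>, so for the first part it remains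
  to see that \<open>V\<^sup>-\<^sup>1(\<M> \<cdot> \<J>) = V\<^sup>-\<^sup>1(\<M>) \<cdot> V\<^sup>-\<^sup>1(\<J>)\<close>. For the second part, testing \<open>(A, h)\<close> against the
  free morphism on \<open>m \<in> \<S>\<close> is testing \<open>A\<close> against \<open>m\<close>; conversely, if \<open>A\<close> is \<open>\<S>\<close>-local, the
  extension \<open>g\<close> of an algebra morphism along \<open>m\<close> is one again, because \<open>g y\<close> and \<open>h (T g)\<close> agree
  after composition with \<open>T m \<in> \<S>\<close>.
\<close>

section \<open>Arrows of a category\<close>

lemma hom_iff: "f \<in> hom C A B \<longleftrightarrow> f \<in> Arr C \<and> Dom C f = A \<and> Cod C f = B"
  by (simp add: hom_def)

lemma composites_I:
  "a \<in> \<A> \<Longrightarrow> b \<in> \<B> \<Longrightarrow> a \<in> Arr C \<Longrightarrow> b \<in> Arr C \<Longrightarrow> Cod C a = Dom C b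
    \<Longrightarrow> b \<cdot>\<^bsub>C\<^esub> a \<in> composites C \<B> \<A>"
  by (auto simp: composites_def)

lemma composites_E:
  assumes "f \<in> composites C \<B> \<A>"
  obtains a b where "a \<in> \<A>" "b \<in> \<B>" "a \<in> Arr C" "b \<in> Arr C" "Cod C a = Dom C b" "f = b \<cdot>\<^bsub>C\<^esub> a"
  using assms by (auto simp: composites_def)

context category
begin

declare dom_in [simp] cod_in [simp]

lemma ident_simps [simp]:
  assumes "A \<in> Obj C"
  shows "Ident C A \<in> Arr C" "Dom C (Ident C A) = A" "Cod C (Ident C A) = A"
  using ident_in [OF assms] by (simp_all add: hom_iff)

lemma comp_simps [simp]:
  assumes "f \<in> Arr C" "g \<in> Arr C" "Dom C g = Cod C f"
  shows "g \<cdot> f \<in> Arr C" "Dom C (g \<cdot> f) = Dom C f" "Cod C (g \<cdot> f) = Cod C g"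
  using comp_in [of f "Dom C f" "Cod C f" g "Cod C g"] assms by (simp_all add: hom_iff)

lemma comp_ident_simp [simp]: "f \<in> Arr C \<Longrightarrow> Dom C f = A \<Longrightarrow> f \<cdot> Ident C A = f"
  by (rule comp_ident [where Y = "Cod C f"]) (simp add: hom_iff)

lemma ident_comp_simp [simp]: "f \<in> Arr C \<Longrightarrow> Cod C f = A \<Longrightarrow> Ident C A \<cdot> f = f"
  by (rule ident_comp [where X = "Dom C f"]) (simp add: hom_iff)

lemma assoc:
  "f \<in> Arr C \<Longrightarrow> g \<in> Arr C \<Longrightarrow> h \<in> Arr C \<Longrightarrow> Dom C g = Cod C f \<Longrightarrow> Dom C h = Cod C g
    \<Longrightarrow> (h \<cdot> g) \<cdot> f = h \<cdot> (g \<cdot> f)"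
  by (rule comp_assoc) (auto simp: hom_iff)

text \<open>Once \<open>assoc\<close> has moved all brackets to the right, the left side of
  \<open>g \<cdot> f = k\<close> no longer occurs inside \<open>g \<cdot> (f \<cdot> x)\<close>;
  this form keeps such an equation usable in longer composites.\<close>

lemma reassoc:
  "g \<cdot> f = k \<Longrightarrow> f \<in> Arr C \<Longrightarrow> g \<in> Arr C \<Longrightarrow> Dom C g = Cod C f \<Longrightarrow>
    x \<in> Arr C \<Longrightarrow> Dom C f = Cod C x \<Longrightarrow> g \<cdot> (f \<cdot> x) = k \<cdot> x"
  using assoc by auto

section \<open>Isomorphisms of a category\<close>

lemma isosI:
  "f \<in> Arr C \<Longrightarrow> g \<in> Arr C \<Longrightarrow> Dom C g = Cod C f \<Longrightarrow> Cod C g = Dom C f \<Longrightarrow>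
    g \<cdot> f = Ident C (Dom C f) \<Longrightarrow> f \<cdot> g = Ident C (Cod C f) \<Longrightarrow> f \<in> isos C"
  by (auto simp: isos_def hom_iff)

lemma isosE:
  assumes "f \<in> isos C"
  obtains g where "f \<in> Arr C" "g \<in> Arr C" "Dom C g = Cod C f" "Cod C g = Dom C f"
    "g \<cdot> f = Ident C (Dom C f)" "f \<cdot> g = Ident C (Cod C f)"
  using assms by (auto simp: isos_def hom_iff)

lemma isos_Arr: "f \<in> isos C \<Longrightarrow> f \<in> Arr C"
  by (auto simp: isos_def)

lemma ident_isos: "A \<in> Obj C \<Longrightarrow> Ident C A \<in> isos C"
  by (rule isosI [of _ "Ident C A"]) simp_all

lemma isos_comp:
  assumes "f \<in> isos C" "g \<in> isos C" "Dom C g = Cod C f"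
  shows "g \<cdot> f \<in> isos C"
proof -
  obtain f' where f: "f \<in> Arr C" "f' \<in> Arr C" "Dom C f' = Cod C f" "Cod C f' = Dom C f"
    "f' \<cdot> f = Ident C (Dom C f)" "f \<cdot> f' = Ident C (Cod C f)"
    using assms(1) by (rule isosE)
  obtain g' where g: "g \<in> Arr C" "g' \<in> Arr C" "Dom C g' = Cod C g" "Cod C g' = Dom C g"
    "g' \<cdot> g = Ident C (Dom C g)" "g \<cdot> g' = Ident C (Cod C g)"
    using assms(2) by (rule isosE)
  show ?thesis
    using f g assms(3)
    by (intro isosI [of _ "f' \<cdot> g'"])
      (simp_all add: assoc reassoc [OF f(5)] reassoc [OF f(6)] reassoc [OF g(5)] reassoc [OF g(6)])
qed

end


section \<open>Double factorization systems\<close>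

context double_factorization_system
begin

lemma E_Arr: "e \<in> \<E> \<Longrightarrow> e \<in> Arr C" using E_subset by blast
lemma J_Arr: "j \<in> \<J> \<Longrightarrow> j \<in> Arr C" using J_subset by blast
lemma M_Arr: "m \<in> \<M> \<Longrightarrow> m \<in> Arr C" using M_subset by blast

lemma isos_comp_E:
  "i \<in> isos C \<Longrightarrow> e \<in> \<E> \<Longrightarrow> Dom C i = Cod C e \<Longrightarrow> i \<cdot> e \<in> \<E>"
  using composites_I [of e \<E> i "isos C" C] iso_E by (auto simp: E_Arr isos_Arr)

lemma isos_comp_J_comp_isos:
  assumes "i \<in> isos C" "j \<in> \<J>" "k \<in> isos C" "Cod C k = Dom C j" "Dom C i = Cod C j"
  shows "i \<cdot> (j \<cdot> k) \<in> \<J>"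
proof -
  have "j \<cdot> k \<in> composites C \<J> (isos C)"
    using assms by (intro composites_I) (simp_all add: J_Arr isos_Arr)
  then have "i \<cdot> (j \<cdot> k) \<in> composites C (isos C) (composites C \<J> (isos C))"
    using assms by (intro composites_I) (simp_all add: J_Arr isos_Arr)
  then show ?thesis using iso_J_iso by blast
qed

lemma M_comp_isos:
  "m \<in> \<M> \<Longrightarrow> i \<in> isos C \<Longrightarrow> Dom C m = Cod C i \<Longrightarrow> m \<cdot> i \<in> \<M>"
  using composites_I [of i "isos C" m \<M> C] M_iso by (auto simp: M_Arr isos_Arr)

lemma factorizationE:
  assumes "f \<in> Arr C"
  obtains m j e where "m \<in> \<M>" "j \<in> \<J>" "e \<in> \<E>" "Dom C j = Cod C e" "Dom C m = Cod C j"
    "Dom C e = Dom C f" "Cod C m = Cod C f" "f = m \<cdot> (j \<cdot> e)"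
proof -
  have "f \<in> composites C \<M> (composites C \<J> \<E>)"
    using assms factorization by blast
  then obtain a m where m: "a \<in> composites C \<J> \<E>" "m \<in> \<M>" "a \<in> Arr C" "m \<in> Arr C"
    "Cod C a = Dom C m" "f = m \<cdot> a"
    by (rule composites_E)
  from m(1) obtain e j where e: "e \<in> \<E>" "j \<in> \<J>" "e \<in> Arr C" "j \<in> Arr C" "Cod C e = Dom C j"
    "a = j \<cdot> e"
    by (rule composites_E)
  show ?thesis
    by (rule that [of m j e]) (use m e in simp_all)
qed

lemma lifting:
  assumes "e \<in> \<E>" "j \<in> \<J>" "j' \<in> \<J>" "m \<in> \<M>" "u \<in> Arr C" "v \<in> Arr C"
    and "Dom C j = Cod C e" "Dom C m = Cod C j'"
    and "Dom C u = Dom C e" "Cod C u = Dom C j'" "Dom C v = Cod C j" "Cod C v = Cod C m"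
    and "v \<cdot> (j \<cdot> e) = m \<cdot> (j' \<cdot> u)"
  shows "\<exists>!(s, t). s \<in> hom C (Cod C e) (Dom C j') \<and> t \<in> hom C (Cod C j) (Dom C m) \<and>
    s \<cdot> e = u \<and> j' \<cdot> s = t \<cdot> j \<and> m \<cdot> t = v"
  using assms
  by (intro unique_lifting [where ?X1.0 = "Dom C e" and ?Y3.0 = "Cod C m"])
    (simp_all add: hom_iff E_Arr J_Arr M_Arr)

lemma lifting_exists:
  assumes "e \<in> \<E>" "j \<in> \<J>" "j' \<in> \<J>" "m \<in> \<M>" "u \<in> Arr C" "v \<in> Arr C"
    and "Dom C j = Cod C e" "Dom C m = Cod C j'"
    and "Dom C u = Dom C e" "Cod C u = Dom C j'" "Dom C v = Cod C j" "Cod C v = Cod C m"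
    and "v \<cdot> (j \<cdot> e) = m \<cdot> (j' \<cdot> u)"
  obtains s t where "s \<in> Arr C" "Dom C s = Cod C e" "Cod C s = Dom C j'"
    "t \<in> Arr C" "Dom C t = Cod C j" "Cod C t = Dom C m"
    "s \<cdot> e = u" "j' \<cdot> s = t \<cdot> j" "m \<cdot> t = v"
  using lifting [OF assms] by (auto simp: hom_iff elim!: ex1E)

text \<open>A pair with \<open>j' \<cdot> s = t \<cdot> j\<close> is itself a diagonal of the square
  with outer sides \<open>s \<cdot> e\<close> and \<open>m \<cdot> t\<close>, so that square
  commutes and the axiom applies. Identities between arrows are thereby reduced to comparing outer
  sides.\<close>

lemma lifting_unique:
  assumes "e \<in> \<E>" "j \<in> \<J>" "j' \<in> \<J>" "m \<in> \<M>"
    and "Dom C j = Cod C e" "Dom C m = Cod C j'"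
    and s: "s \<in> Arr C" "Dom C s = Cod C e" "Cod C s = Dom C j'"
    and t: "t \<in> Arr C" "Dom C t = Cod C j" "Cod C t = Dom C m"
    and s': "s' \<in> Arr C" "Dom C s' = Cod C e" "Cod C s' = Dom C j'"
    and t': "t' \<in> Arr C" "Dom C t' = Cod C j" "Cod C t' = Dom C m"
    and eq: "j' \<cdot> s = t \<cdot> j" and "j' \<cdot> s' = t' \<cdot> j" "s' \<cdot> e = s \<cdot> e" "m \<cdot> t' = m \<cdot> t"
  shows "s = s' \<and> t = t'"
proof -
  note a = E_Arr [OF assms(1)] J_Arr [OF assms(2)] J_Arr [OF assms(3)] M_Arr [OF assms(4)]
  have "(m \<cdot> t) \<cdot> (j \<cdot> e) = m \<cdot> (j' \<cdot> (s \<cdot> e))"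
    using a assms(5-12) by (simp add: assoc reassoc [OF eq])
  then have "\<exists>!(x, y). x \<in> hom C (Cod C e) (Dom C j') \<and> y \<in> hom C (Cod C j) (Dom C m) \<and>
    x \<cdot> e = s \<cdot> e \<and> j' \<cdot> x = y \<cdot> j \<and> m \<cdot> y = m \<cdot> t"
    using assms a by (intro lifting) simp_all
  then have uniq: "\<exists>\<^sub>\<le>\<^sub>1(x, y). x \<in> hom C (Cod C e) (Dom C j') \<and> y \<in> hom C (Cod C j) (Dom C m) \<and>
    x \<cdot> e = s \<cdot> e \<and> j' \<cdot> x = y \<cdot> j \<and> m \<cdot> y = m \<cdot> t"
    by (simp only: ex1_iff_ex_Uniq)
  have "(s, t) = (s', t')"
    by (rule Uniq_D [OF uniq]) (use assms in \<open>simp_all add: hom_iff\<close>)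
  then show ?thesis by simp
qed

text \<open>In \<open>1 = m j e\<close> the pair \<open>(e m j, j e m)\<close> is an endomorphism of the
  factorization, hence trivial, so that \<open>m\<close>, \<open>j\<close> and \<open>e\<close> are invertible.\<close>

lemma ident_mem:
  assumes A: "A \<in> Obj C"
  shows "Ident C A \<in> \<E>" "Ident C A \<in> \<J>" "Ident C A \<in> \<M>"
proof -
  have "Ident C A \<in> Arr C" using A by simp
  then obtain m j e where mem: "m \<in> \<M>" "j \<in> \<J>" "e \<in> \<E>"
    and d': "Dom C j = Cod C e" "Dom C m = Cod C j" "Dom C e = Dom C (Ident C A)"
      "Cod C m = Cod C (Ident C A)"
    and eq: "Ident C A = m \<cdot> (j \<cdot> e)"
    by (rule factorizationE)
  note d = d' [unfolded ident_simps(2,3) [OF A]]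
  note a = E_Arr [OF mem(3)] J_Arr [OF mem(2)] M_Arr [OF mem(1)]
  note eq = eq [symmetric]
  have mj: "(m \<cdot> j) \<cdot> e = Ident C A" using eq a d by (simp add: assoc)
  have mjem: "m \<cdot> (j \<cdot> (e \<cdot> m)) = m"
    using reassoc [OF eq, of m] a d A by (simp add: assoc)
  have "e \<cdot> (m \<cdot> j) = Ident C (Cod C e) \<and> j \<cdot> (e \<cdot> m) = Ident C (Cod C j)"
    by (rule lifting_unique [of e j j m])
      (use a d mem eq mjem A in \<open>simp_all add: assoc\<close>)
  then have em: "e \<cdot> (m \<cdot> j) = Ident C (Cod C e)" and je: "j \<cdot> (e \<cdot> m) = Ident C (Cod C j)"
    by simp_all
  have inv: "m \<in> isos C" "j \<in> isos C" "e \<in> isos C"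
    using a d A eq em je
    by (auto intro!: isosI [of m "j \<cdot> e"] isosI [of j "e \<cdot> m"] isosI [of e "m \<cdot> j"] simp: assoc)
  \<comment> \<open>The identity is bracketed as an isomorphism after \<open>e\<close>, as
    \<open>j\<close> between two isomorphisms, and as \<open>m\<close> after an isomorphism, to
    match the three closure axioms.\<close>
  show "Ident C A \<in> \<E>"
    using isos_comp_E [of "m \<cdot> j" e] isos_comp [of j m] mem inv a d mj by simp
  show "Ident C A \<in> \<J>"
    using isos_comp_J_comp_isos [of m j e] mem inv a d eq by simp
  show "Ident C A \<in> \<M>"
    using M_comp_isos [of m "j \<cdot> e"] isos_comp [of e j] mem inv a d eq by simp
qed

section \<open>Orthogonality and the characterization of the left class\<close>

text \<open>Identities belong to \<open>\<J>\<close>, so a square from \<open>e\<close> to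
  \<open>m \<cdot> j\<close> is a lifting problem with the identity of \<open>Cod C e\<close> as its
  first bifibrant arrow. The second component of a solution is forced to be
  \<open>j \<cdot> s\<close>, and only \<open>s\<close> remains.\<close>

lemma orthogonal_E_MJ:
  assumes e: "e \<in> \<E>" and g: "g \<in> composites C \<M> \<J>"
  shows "orthogonal C e g"
proof -
  obtain j m where mj: "j \<in> \<J>" "m \<in> \<M>" "j \<in> Arr C" "m \<in> Arr C" "Cod C j = Dom C m" "g = m \<cdot> j"
    using g by (rule composites_E)
  have ea: "e \<in> Arr C" using e by (rule E_Arr)
  let ?I = "Ident C (Cod C e)"
  have one: "?I \<in> \<J>" using ea ident_mem by simp
  show ?thesis
    unfolding orthogonal_def
  proof (intro ballI impI)
    fix u v
    assume "u \<in> hom C (Dom C e) (Dom C g)" "v \<in> hom C (Cod C e) (Cod C g)"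
      and eq: "v \<cdot> e = g \<cdot> u"
    then have u: "u \<in> Arr C" "Dom C u = Dom C e" "Cod C u = Dom C j"
      and v: "v \<in> Arr C" "Dom C v = Cod C e" "Cod C v = Cod C m"
      using mj by (simp_all add: hom_iff)
    obtain s t where st: "s \<in> Arr C" "Dom C s = Cod C e" "Cod C s = Dom C j"
      "t \<in> Arr C" "Dom C t = Cod C ?I" "Cod C t = Dom C m"
      "s \<cdot> e = u" "j \<cdot> s = t \<cdot> ?I" "m \<cdot> t = v"
      by (rule lifting_exists [of e ?I j m u v]) (use e one mj u v ea eq in \<open>simp_all add: assoc\<close>)
    show "\<exists>!d. d \<in> hom C (Cod C e) (Dom C g) \<and> d \<cdot> e = u \<and> g \<cdot> d = v"
    proof (rule ex1I [of _ s])
      show "s \<in> hom C (Cod C e) (Dom C g) \<and> s \<cdot> e = u \<and> g \<cdot> s = v"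
        using st mj ea by (simp add: hom_iff assoc)
    next
      fix d
      assume "d \<in> hom C (Cod C e) (Dom C g) \<and> d \<cdot> e = u \<and> g \<cdot> d = v"
      then have "s = d \<and> t = j \<cdot> d"
        using st mj ea one e
        by (intro lifting_unique [of e ?I j m]) (auto simp: hom_iff assoc)
      then show "d = s" by simp
    qed
  qed
qed

lemma orthogonalD:
  assumes "orthogonal C f g" "u \<in> Arr C" "v \<in> Arr C"
    "Dom C u = Dom C f" "Cod C u = Dom C g" "Dom C v = Cod C f" "Cod C v = Cod C g"
    "v \<cdot> f = g \<cdot> u"
  shows "\<exists>!d. d \<in> hom C (Cod C f) (Dom C g) \<and> d \<cdot> f = u \<and> g \<cdot> d = v"
  using assms by (simp add: orthogonal_def hom_iff)

text \<open>For the harder inclusion, \<open>f\<close> is factored as a fibration \<open>g\<close>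
  after some \<open>e\<close> in \<open>\<E>\<close>. Comparing fillers makes \<open>g\<close>
  invertible, and \<open>\<E>\<close> absorbs isomorphisms on the left.\<close>

lemma E_eq_left_orthogonal: "\<E> = left_orthogonal C (composites C \<M> \<J>)"
proof
  show "\<E> \<subseteq> left_orthogonal C (composites C \<M> \<J>)"
    by (auto simp: left_orthogonal_def E_Arr intro: orthogonal_E_MJ)
  show "left_orthogonal C (composites C \<M> \<J>) \<subseteq> \<E>"
  proof
    fix f
    assume "f \<in> left_orthogonal C (composites C \<M> \<J>)"
    then have f: "f \<in> Arr C" and orth: "\<And>g. g \<in> composites C \<M> \<J> \<Longrightarrow> orthogonal C f g"
      by (auto simp: left_orthogonal_def)
    obtain m j e where mem: "m \<in> \<M>" "j \<in> \<J>" "e \<in> \<E>"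
      and d: "Dom C j = Cod C e" "Dom C m = Cod C j" "Dom C e = Dom C f" "Cod C m = Cod C f"
      and eq: "f = m \<cdot> (j \<cdot> e)"
      using f by (rule factorizationE)
    note a = E_Arr [OF mem(3)] J_Arr [OF mem(2)] M_Arr [OF mem(1)]
    define g where "g = m \<cdot> j"
    have g: "g \<in> composites C \<M> \<J>" "g \<in> Arr C" "Dom C g = Cod C e" "Cod C g = Cod C f"
      and fg: "g \<cdot> e = f"
      using mem d a eq by (auto simp: g_def assoc intro: composites_I)
    \<comment> \<open>The square from \<open>f\<close> to \<open>g\<close> with sides
      \<open>e\<close> and the identity yields a right inverse \<open>x\<close> of
      \<open>g\<close>.\<close>
    have "\<exists>!x. x \<in> hom C (Cod C f) (Dom C g) \<and> x \<cdot> f = e \<and> g \<cdot> x = Ident C (Cod C f)"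
      using orth [OF g(1)] f g a d fg by (intro orthogonalD) simp_all
    then obtain x where x: "x \<in> Arr C" "Dom C x = Cod C f" "Cod C x = Dom C g" "x \<cdot> f = e"
      "g \<cdot> x = Ident C (Cod C f)"
      by (auto simp: hom_iff)
    \<comment> \<open>Both \<open>x \<cdot> g\<close> and the identity fill the square from
      \<open>e\<close> to \<open>g\<close> with sides \<open>e\<close> and \<open>g\<close>, so
      \<open>x\<close> is also a left inverse.\<close>
    have "\<exists>!y. y \<in> hom C (Cod C e) (Dom C g) \<and> y \<cdot> e = e \<and> g \<cdot> y = g"
      using orthogonal_E_MJ [OF mem(3) g(1)] a g d by (intro orthogonalD) simp_all
    moreover have "x \<cdot> g \<in> hom C (Cod C e) (Dom C g)" "(x \<cdot> g) \<cdot> e = e" "g \<cdot> (x \<cdot> g) = g"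
      "Ident C (Cod C e) \<in> hom C (Cod C e) (Dom C g)" "Ident C (Cod C e) \<cdot> e = e"
      "g \<cdot> Ident C (Cod C e) = g"
      using a d g x f fg by (simp_all add: hom_iff assoc reassoc [OF x(5)])
    ultimately have "x \<cdot> g = Ident C (Cod C e)" by blast
    then have "g \<in> isos C" using g x by (intro isosI [of g x]) simp_all
    then show "f \<in> \<E>" using isos_comp_E [of g e] g mem fg by simp
  qed
qed

end

section \<open>Images of arrows under a functor\<close>

declare (in category_functor) ob_in [simp]

lemma (in category_functor) functor_simps [simp]:
  assumes "f \<in> Arr C"
  shows "ar F f \<in> Arr D" "Dom D (ar F f) = ob F (Dom C f)" "Cod D (ar F f) = ob F (Cod C f)"
  using ar_in [of f "Dom C f" "Cod C f"] assms by (simp_all add: hom_iff)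

lemma (in category_functor) functor_comp:
  "f \<in> Arr C \<Longrightarrow> g \<in> Arr C \<Longrightarrow> Dom C g = Cod C f \<Longrightarrow>
    ar F (g \<cdot>\<^bsub>C\<^esub> f) = ar F g \<cdot>\<^bsub>D\<^esub> ar F f"
  by (rule ar_comp) (auto simp: hom_iff)


section \<open>Eilenberg--Moore algebras\<close>

context monad
begin

abbreviation (input) "EM \<equiv> em_category C T \<eta> \<mu>"

lemma EM_simps [simp]:
  "Dom EM (a, b, f) = a" "Cod EM (a, b, f) = b" "Ident EM a = (a, a, Ident C (fst a))"
  "Comp EM (b', c, g) (a, b, f) = (a, c, g \<cdot> f)"
  by (simp_all add: em_category_def split: prod.split)

lemma EM_Obj: "(A, h) \<in> Obj EM \<longleftrightarrow> A \<in> Obj C \<and> h \<in> Arr C \<and> Dom C h = ob T A \<and> Cod C h = A \<and>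
    h \<cdot> \<eta> A = Ident C A \<and> h \<cdot> \<mu> A = h \<cdot> ar T h"
  by (auto simp: em_category_def em_algebras_def hom_iff)

lemma EM_Arr: "(a, b, f) \<in> Arr EM \<longleftrightarrow> a \<in> Obj EM \<and> b \<in> Obj EM \<and>
    f \<in> Arr C \<and> Dom C f = fst a \<and> Cod C f = fst b \<and> f \<cdot> snd a = snd b \<cdot> ar T f"
  by (auto simp: em_category_def hom_iff split: prod.split)

lemma EM_hom: "x \<in> hom EM a b \<longleftrightarrow> (\<exists>f. x = (a, b, f) \<and> (a, b, f) \<in> Arr EM)"
  by (cases x) (auto simp: hom_iff)

lemma forgetful_simps [simp]:
  "ob em_forgetful (A, h) = A" "ar em_forgetful (a, b, f) = f"
  by (simp_all add: em_forgetful_def)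

lemma unit_simps [simp]:
  assumes "A \<in> Obj C"
  shows "\<eta> A \<in> Arr C" "Dom C (\<eta> A) = A" "Cod C (\<eta> A) = ob T A"
  using unit.component_in [OF assms] by (simp_all add: hom_iff fident_def)

lemma mult_simps [simp]:
  assumes "A \<in> Obj C"
  shows "\<mu> A \<in> Arr C" "Dom C (\<mu> A) = ob T (ob T A)" "Cod C (\<mu> A) = ob T A"
  using mult.component_in [OF assms] by (simp_all add: hom_iff fcomp_def)

lemma unit_natural: "f \<in> Arr C \<Longrightarrow> \<eta> (Cod C f) \<cdot> f = ar T f \<cdot> \<eta> (Dom C f)"
  using unit.natural [of f "Dom C f" "Cod C f"] by (simp add: hom_iff fident_def)

lemma mult_natural:
  "f \<in> Arr C \<Longrightarrow> Dom C f = A \<Longrightarrow> Cod C f = B \<Longrightarrow> ar T f \<cdot> \<mu> A = \<mu> B \<cdot> ar T (ar T f)"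
  using mult.natural [of f A B] by (simp add: hom_iff fcomp_def)

section \<open>The category of algebras and the free adjunction\<close>

lemma category_EM: "category EM"
proof
  fix f assume "f \<in> Arr EM"
  then show "Dom EM f \<in> Obj EM" "Cod EM f \<in> Obj EM"
    by (cases f; simp add: EM_Arr)+
next
  fix A assume "A \<in> Obj EM"
  then show "Ident EM A \<in> hom EM A A"
    by (cases A) (auto simp: EM_hom EM_Arr EM_Obj ar_ident)
next
  fix f g X Y Z assume "f \<in> hom EM X Y" "g \<in> hom EM Y Z"
  then obtain f' g' where fg: "f = (X, Y, f')" "g = (Y, Z, g')"
    and arr: "(X, Y, f') \<in> Arr EM" "(Y, Z, g') \<in> Arr EM"
    by (auto simp: EM_hom)
  obtain A h B k D l where "X = (A, h)" "Y = (B, k)" "Z = (D, l)"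
    by (metis surj_pair)
  note XYZ = this
  have f': "f' \<in> Arr C" "Dom C f' = A" "Cod C f' = B" "f' \<cdot> h = k \<cdot> ar T f'"
    and g': "g' \<in> Arr C" "Dom C g' = B" "Cod C g' = D" "g' \<cdot> k = l \<cdot> ar T g'"
    and h: "h \<in> Arr C" "Cod C h = A" "k \<in> Arr C" "Dom C k = ob T B" "Cod C k = B"
      "l \<in> Arr C" "Dom C l = ob T D"
    using arr by (simp_all add: XYZ EM_Arr EM_Obj)
  have "(g' \<cdot> f') \<cdot> h = l \<cdot> ar T (g' \<cdot> f')"
    using f' g' h by (simp add: functor_comp dom_cat.assoc dom_cat.reassoc [OF g'(4)])
  with arr f' g' show "Comp EM g f \<in> hom EM X Z"
    by (simp add: fg XYZ EM_hom EM_Arr)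
next
  fix f X Y assume "f \<in> hom EM X Y"
  then show "Comp EM f (Ident EM X) = f" "Comp EM (Ident EM Y) f = f"
    by (auto simp: EM_hom EM_Arr)
next
  fix f g h X Y Z W assume "f \<in> hom EM X Y" "g \<in> hom EM Y Z" "h \<in> hom EM Z W"
  then show "Comp EM (Comp EM h g) f = Comp EM h (Comp EM g f)"
    by (auto simp: EM_hom EM_Arr dom_cat.assoc)
qed

lemma free_algebra: "A \<in> Obj C \<Longrightarrow> (ob T A, \<mu> A) \<in> Obj EM"
  by (simp add: EM_Obj ob_in unit_left mult_assoc)

lemma free_morphism:
  "f \<in> Arr C \<Longrightarrow>
    ((ob T (Dom C f), \<mu> (Dom C f)), (ob T (Cod C f), \<mu> (Cod C f)), ar T f) \<in> Arr EM"
  by (simp add: EM_Arr free_algebra mult_natural)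

text \<open>One triangle identity is the law \<open>unit_right\<close> of the monad, the other is
  the unit law of an algebra; naturality of the counit is the defining equation of algebra
  morphisms.\<close>

lemma adjunction_EM: "adjunction C EM (em_free C T \<mu>) em_forgetful \<eta> (em_counit T \<mu>)"
proof -
  interpret EM: category EM by (rule category_EM)
  interpret V: category_functor EM C em_forgetful
    by unfold_locales (auto simp: EM_Obj EM_hom EM_Arr hom_iff)
  interpret F: category_functor C EM "em_free C T \<mu>"
    by unfold_locales
      (auto simp: em_free_def free_algebra EM_hom hom_iff free_morphism ar_ident functor_comp)
  show ?thesis
    by unfold_locales
      (auto simp: fident_def fcomp_def em_free_def em_counit_def free_algebra EM_hom EM_Arr EM_Obj
        hom_iff ar_ident functor_comp unit_natural unit_left unit_right free_morphism mult_assoc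
        intro: mult_natural)
qed

text \<open>The forgetful functor preserves isomorphisms, which transfers the closure axioms to
  algebras. It reflects them because the inverse of an algebra morphism automatically respects the
  structure maps.\<close>

lemma isos_EM:
  assumes "(a, b, f) \<in> Arr EM"
  shows "(a, b, f) \<in> isos EM \<longleftrightarrow> f \<in> isos C"
proof
  interpret EM: category EM by (rule category_EM)
  assume "(a, b, f) \<in> isos EM"
  then obtain g where g: "g \<in> Arr EM" "Dom EM g = b" "Cod EM g = a"
    "Comp EM g (a, b, f) = Ident EM a" "Comp EM (a, b, f) g = Ident EM b"
    by (auto elim: EM.isosE)
  then obtain g' where "g = (b, a, g')"
    by (cases g) simp
  with g assms show "f \<in> isos C"
    by (intro dom_cat.isosI [of f g']) (simp_all add: EM_Arr)
next
  interpret EM: category EM by (rule category_EM)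
  assume "f \<in> isos C"
  then obtain g where f: "f \<in> Arr C" and g: "g \<in> Arr C" "Dom C g = Cod C f" "Cod C g = Dom C f"
    "g \<cdot> f = Ident C (Dom C f)" "f \<cdot> g = Ident C (Cod C f)"
    by (rule dom_cat.isosE)
  obtain A h B k where ab: "a = (A, h)" "b = (B, k)" by (metis surj_pair)
  have h: "B \<in> Obj C" "h \<in> Arr C" "Dom C h = ob T A" "Cod C h = A"
    "k \<in> Arr C" "Dom C k = ob T B" "Cod C k = B"
    and f': "Dom C f = A" "Cod C f = B" "f \<cdot> h = k \<cdot> ar T f"
    using assms by (simp_all add: EM_Arr EM_Obj ab)
  \<comment> \<open>As \<open>ar T g\<close> is right inverse to \<open>ar T f\<close>, the morphism
    law of \<open>f\<close> can be solved for \<open>k\<close>; cancelling \<open>f\<close> on the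
    left then gives the law for \<open>g\<close>.\<close>
  have "k = (k \<cdot> ar T f) \<cdot> ar T g"
    using f f' g h by (simp add: dom_cat.assoc ar_ident flip: functor_comp)
  also have "\<dots> = f \<cdot> (h \<cdot> ar T g)"
    using f f' g h by (simp add: dom_cat.assoc flip: f'(3))
  finally have "g \<cdot> k = g \<cdot> (f \<cdot> (h \<cdot> ar T g))" by simp
  also have "\<dots> = h \<cdot> ar T g"
    using f f' g h by (simp add: dom_cat.reassoc [OF g(4)])
  finally have "(b, a, g) \<in> Arr EM"
    using assms f' g by (simp add: EM_Arr ab)
  then show "(a, b, f) \<in> isos EM"
    using assms f' g by (intro EM.isosI [of _ "(b, a, g)"]) (simp_all add: ab)
qed

lemma preimage_EM:
  "(a, b, f) \<in> preimage_class EM em_forgetful \<A> \<longleftrightarrow> (a, b, f) \<in> Arr EM \<and> f \<in> \<A>"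
  by (simp add: preimage_class_def)

text \<open>The arrow \<open>h \<cdot> ar T f\<close> is the adjoint transpose of \<open>f\<close>.
  It respects the structure maps by naturality of \<mu> and the multiplication law of
  \<open>h\<close>.\<close>

lemma free_extension:
  assumes "(A, h) \<in> Obj EM" "f \<in> Arr C" "Cod C f = A"
  shows "((ob T (Dom C f), \<mu> (Dom C f)), (A, h), h \<cdot> ar T f) \<in> Arr EM"
proof -
  have h: "A \<in> Obj C" "h \<in> Arr C" "Dom C h = ob T A" "Cod C h = A" and hm: "h \<cdot> \<mu> A = h \<cdot> ar T h"
    using assms by (simp_all add: EM_Obj)
  have "(h \<cdot> ar T f) \<cdot> \<mu> (Dom C f) = h \<cdot> (\<mu> A \<cdot> ar T (ar T f))"
    using assms h mult_natural [OF assms(2) refl assms(3)] by (simp add: dom_cat.assoc)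
  also have "\<dots> = h \<cdot> ar T (h \<cdot> ar T f)"
    using assms h by (simp add: dom_cat.assoc dom_cat.reassoc [OF hm] functor_comp)
  finally show ?thesis
    using assms h by (simp add: EM_Arr free_algebra)
qed

end


section \<open>Local objects\<close>

text \<open>Bijectivity of precomposition is traded for unique extension along \<open>m\<close>, the
  form in which extensions are built and compared. That \<open>\<L>\<close> consists of arrows
  ensures that precomposition lands in the right hom-set.\<close>

lemma (in category) local_object_iff:
  assumes "\<L> \<subseteq> Arr C"
  shows "local_object C \<L> X \<longleftrightarrow> X \<in> Obj C \<and> (\<forall>m\<in>\<L>. \<forall>f\<in>hom C (Dom C m) X.
    \<exists>!g. g \<in> hom C (Cod C m) X \<and> g \<cdot> m = f)"
proof -
  have "bij_betw (\<lambda>g. g \<cdot> m) (hom C (Cod C m) X) (hom C (Dom C m) X) \<longleftrightarrow>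
      (\<forall>f\<in>hom C (Dom C m) X. \<exists>!g. g \<in> hom C (Cod C m) X \<and> g \<cdot> m = f)" (is "?L \<longleftrightarrow> ?R")
    if "m \<in> \<L>" for m
  proof
    assume L: ?L
    show ?R
    proof
      fix f assume "f \<in> hom C (Dom C m) X"
      then have "f \<in> (\<lambda>g. g \<cdot> m) ` hom C (Cod C m) X"
        by (simp only: bij_betw_imp_surj_on [OF L])
      then obtain g where "g \<in> hom C (Cod C m) X" "g \<cdot> m = f"
        by blast
      then show "\<exists>!g. g \<in> hom C (Cod C m) X \<and> g \<cdot> m = f"
        using bij_betw_imp_inj_on [OF L] by (intro ex1I [of _ g]) (auto dest: inj_onD)
    qed
  next
    assume R: ?R
    have comp: "g \<cdot> m \<in> hom C (Dom C m) X" if "g \<in> hom C (Cod C m) X" for g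
      using that \<open>m \<in> \<L>\<close> assms by (auto simp: hom_iff)
    show ?L
    proof (rule bij_betwI')
      show "g \<cdot> m = g' \<cdot> m \<longleftrightarrow> g = g'" if "g \<in> hom C (Cod C m) X" "g' \<in> hom C (Cod C m) X" for g g'
        using R comp that by blast
    qed (use R comp in blast)+
  qed
  then show ?thesis by (auto simp: local_object_def)
qed

text \<open>With both ends fixed, an arrow of algebras is just its underlying arrow, so unique
  existence can be stated without the triples.\<close>

lemma (in monad) EM_ex1_hom:
  "(\<exists>!x. x \<in> hom EM b c \<and> Comp EM x (a, b, m) = (a, c, f)) \<longleftrightarrow>
    (\<exists>!g. (b, c, g) \<in> Arr EM \<and> g \<cdot> m = f)"
proof -
  have "x \<in> hom EM b c \<and> Comp EM x (a, b, m) = (a, c, f) \<longleftrightarrow>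
      (\<exists>g. x = (b, c, g) \<and> (b, c, g) \<in> Arr EM \<and> g \<cdot> m = f)" for x
    by (auto simp: EM_hom)
  moreover have "(\<exists>!x. \<exists>g. x = (b, c, g) \<and> Q g) \<longleftrightarrow> (\<exists>!g. Q g)" for Q
  proof
    assume L: "\<exists>!x. \<exists>g. x = (b, c, g) \<and> Q g"
    then obtain g where "Q g" by blast
    moreover have "g' = g" if "Q g'" for g'
    proof -
      have "(b, c, g') = (b, c, g)" using L \<open>Q g\<close> that by blast
      then show ?thesis by simp
    qed
    ultimately show "\<exists>!g. Q g" by blast
  qed auto
  ultimately show ?thesis by (simp only:)
qed

text \<open>Phrased for any class of arrows stable under \<open>T\<close>, so that
  \<open>\<J>\<close> and the cofibrations are covered at once.\<close>

lemma (in monad) local_object_EM_iff: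
  assumes S: "\<S> \<subseteq> Arr C" and T_S: "\<And>f. f \<in> \<S> \<Longrightarrow> ar T f \<in> \<S>" and Ah: "(A, h) \<in> Obj EM"
  shows "local_object EM (preimage_class EM em_forgetful \<S>) (A, h) \<longleftrightarrow> local_object C \<S> A"
proof -
  interpret EM: category EM by (rule category_EM)
  have S_EM: "preimage_class EM em_forgetful \<S> \<subseteq> Arr EM"
    by (auto simp: preimage_class_def)
  have h: "A \<in> Obj C" "h \<in> Arr C" "Dom C h = ob T A" "Cod C h = A"
    and h_unit: "h \<cdot> \<eta> A = Ident C A"
    using Ah by (simp_all add: EM_Obj)
  show ?thesis
  proof
    assume "local_object EM (preimage_class EM em_forgetful \<S>) (A, h)"
    then have all: "\<forall>m\<in>preimage_class EM em_forgetful \<S>. \<forall>f\<in>hom EM (Dom EM m) (A, h).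
        \<exists>!g. g \<in> hom EM (Cod EM m) (A, h) \<and> Comp EM g m = f"
      unfolding EM.local_object_iff [OF S_EM] by (rule conjunct2)
    have loc: "\<exists>!g. (Y, (A, h), g) \<in> Arr EM \<and> g \<cdot> m = f"
      if "m \<in> \<S>" "(X, Y, m) \<in> Arr EM" "(X, (A, h), f) \<in> Arr EM" for X Y m f
    proof -
      have "(X, Y, m) \<in> preimage_class EM em_forgetful \<S>"
        "(X, (A, h), f) \<in> hom EM (Dom EM (X, Y, m)) (A, h)"
        using that by (simp_all add: preimage_EM EM_hom)
      from all [rule_format, OF this] show ?thesis
        by (simp only: EM_simps EM_ex1_hom)
    qed
    have "\<exists>!g. g \<in> hom C (Cod C m) A \<and> g \<cdot> m = f"
      if m: "m \<in> \<S>" and f: "f \<in> hom C (Dom C m) A" for m f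
    proof -
      let ?X = "Dom C m" and ?Y = "Cod C m"
      have ma: "m \<in> Arr C" using m S by blast
      have fa: "f \<in> Arr C" "Dom C f = ?X" "Cod C f = A" using f by (simp_all add: hom_iff)
      \<comment> \<open>The extension problem is transposed: instead of \<open>f\<close> along
        \<open>m\<close>, the arrow \<open>h \<cdot> ar T f\<close> is extended along the free
        morphism on \<open>m\<close>, which lies over \<open>\<S>\<close>.\<close>
      have ex1: "\<exists>!g. ((ob T ?Y, \<mu> ?Y), (A, h), g) \<in> Arr EM \<and> g \<cdot> ar T m = h \<cdot> ar T f"
        using free_extension [OF Ah fa(1,3)] fa
        by (intro loc [OF T_S [OF m] free_morphism [OF ma]]) simp
      then obtain g where gEM: "((ob T ?Y, \<mu> ?Y), (A, h), g) \<in> Arr EM" and "g \<cdot> ar T m = h \<cdot> ar T f"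
        by blast
      then have g: "g \<in> Arr C" "Dom C g = ob T ?Y" "Cod C g = A" "g \<cdot> ar T m = h \<cdot> ar T f"
        by (simp_all add: EM_Arr)
      \<comment> \<open>Restricting a transpose along the unit recovers the arrow, by naturality of
        \<eta> and the unit law of \<open>h\<close>.\<close>
      have unit_f: "h \<cdot> (ar T d \<cdot> \<eta> (Dom C d)) = d" if "d \<in> Arr C" "Cod C d = A" for d
        using h that by (simp add: dom_cat.reassoc [OF h_unit] flip: unit_natural)
      show ?thesis
      proof (rule ex1I [of _ "g \<cdot> \<eta> ?Y"])
        have "(g \<cdot> \<eta> ?Y) \<cdot> m = h \<cdot> (ar T f \<cdot> \<eta> (Dom C f))"
          using g h fa ma
          by (simp add: dom_cat.assoc unit_natural dom_cat.reassoc [OF g(4)])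
        then show "g \<cdot> \<eta> ?Y \<in> hom C ?Y A \<and> (g \<cdot> \<eta> ?Y) \<cdot> m = f"
          using g ma fa unit_f [of f] by (simp add: hom_iff)
      next
        \<comment> \<open>The transpose of any other extension \<open>d\<close> solves the same
          problem as \<open>g\<close>, hence equals \<open>g\<close>; restricting along the unit
          determines \<open>d\<close>.\<close>
        fix d assume "d \<in> hom C ?Y A \<and> d \<cdot> m = f"
        then have d: "d \<in> Arr C" "Dom C d = ?Y" "Cod C d = A" "d \<cdot> m = f"
          by (simp_all add: hom_iff)
        have "(h \<cdot> ar T d) \<cdot> ar T m = h \<cdot> ar T f"
          using d h ma by (simp add: dom_cat.assoc flip: functor_comp)
        moreover have "((ob T ?Y, \<mu> ?Y), (A, h), h \<cdot> ar T d) \<in> Arr EM"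
          using free_extension [OF Ah d(1,3)] d by simp
        ultimately have "h \<cdot> ar T d = g"
          using ex1 gEM g(4) by blast
        then have "g \<cdot> \<eta> ?Y = h \<cdot> (ar T d \<cdot> \<eta> (Dom C d))"
          using d h ma by (simp add: dom_cat.assoc [symmetric])
        then show "d = g \<cdot> \<eta> ?Y" using unit_f [of d] d by simp
      qed
    qed
    then show "local_object C \<S> A"
      using h by (simp add: dom_cat.local_object_iff [OF S])
  next
    assume "local_object C \<S> A"
    then have loc: "\<exists>!g. g \<in> hom C (Cod C m) A \<and> g \<cdot> m = f"
      if "m \<in> \<S>" "f \<in> hom C (Dom C m) A" for m f
      using that by (simp add: dom_cat.local_object_iff [OF S])
    have "\<exists>!g. g \<in> hom EM (Cod EM m) (A, h) \<and> Comp EM g m = f"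
      if m_in: "m \<in> preimage_class EM em_forgetful \<S>"
        and f_in: "f \<in> hom EM (Dom EM m) (A, h)" for m f
    proof -
      obtain X x Y y m' where m: "m = ((X, x), (Y, y), m')" by (metis surj_pair)
      obtain f' where f: "f = ((X, x), (A, h), f')" "((X, x), (A, h), f') \<in> Arr EM"
        using f_in by (auto simp: m EM_hom)
      have mS: "m' \<in> \<S>" "((X, x), (Y, y), m') \<in> Arr EM"
        using m_in by (simp_all add: m preimage_EM)
      then have ma: "m' \<in> Arr C" "Dom C m' = X" "Cod C m' = Y" "m' \<cdot> x = y \<cdot> ar T m'"
        and x: "x \<in> Arr C" "Dom C x = ob T X" "Cod C x = X"
        and y: "y \<in> Arr C" "Dom C y = ob T Y" "Cod C y = Y"
        by (simp_all add: EM_Arr EM_Obj)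
      have fa: "f' \<in> Arr C" "Dom C f' = X" "Cod C f' = A" "f' \<cdot> x = h \<cdot> ar T f'"
        using f by (simp_all add: EM_Arr)
      have ex1: "\<exists>!g. g \<in> hom C Y A \<and> g \<cdot> m' = f'"
        using loc [OF mS(1), of f'] ma fa by (simp add: hom_iff)
      then obtain g where g: "g \<in> Arr C" "Dom C g = Y" "Cod C g = A" "g \<cdot> m' = f'"
        by (auto simp: hom_iff)
      \<comment> \<open>Locality against \<open>ar T m'\<close> identifies
        \<open>g \<cdot> y\<close> with \<open>h \<cdot> ar T g\<close>: both extend
        \<open>f' \<cdot> x\<close>, the former because \<open>m'\<close> and the latter because
        \<open>f'\<close> is an algebra morphism.\<close>
      have "\<exists>!d. d \<in> hom C (ob T Y) A \<and> d \<cdot> ar T m' = f' \<cdot> x"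
        using loc [OF T_S [OF mS(1)], of "f' \<cdot> x"] ma fa x h by (simp add: hom_iff)
      moreover have "(g \<cdot> y) \<cdot> ar T m' = f' \<cdot> x"
        using g y ma x by (simp add: dom_cat.assoc dom_cat.reassoc [OF g(4)] flip: ma(4))
      moreover have "(h \<cdot> ar T g) \<cdot> ar T m' = f' \<cdot> x"
        using g h ma fa by (simp add: dom_cat.assoc flip: functor_comp)
      moreover have "g \<cdot> y \<in> hom C (ob T Y) A" "h \<cdot> ar T g \<in> hom C (ob T Y) A"
        using g y h by (simp_all add: hom_iff)
      ultimately have "g \<cdot> y = h \<cdot> ar T g" by blast
      then have "((Y, y), (A, h), g) \<in> Arr EM"
        using g mS(2) Ah by (simp add: EM_Arr)
      then have "\<exists>!g. ((Y, y), (A, h), g) \<in> Arr EM \<and> g \<cdot> m' = f'"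
        by (rule ex1I [of _ g, OF conjI]) (use g ex1 in \<open>auto simp: EM_Arr hom_iff\<close>)
      then show ?thesis
        by (simp add: m f EM_ex1_hom)
    qed
    then show "local_object EM (preimage_class EM em_forgetful \<S>) (A, h)"
      using Ah by (simp add: EM.local_object_iff [OF S_EM])
  qed
qed


section \<open>The lifted double factorization system\<close>

locale monad_preserving_dfs =
  double_factorization_system C \<E> \<J> \<M> + monad C T \<eta> \<mu>
  for C :: "('o, 'm) category" (structure) and \<E> \<J> \<M> :: "'m set"
    and T :: "('o, 'm, 'o, 'm) fctr" and \<eta> \<mu> :: "'o \<Rightarrow> 'm" +
  assumes T_E: "e \<in> \<E> \<Longrightarrow> ar T e \<in> \<E>"
    and T_J: "j \<in> \<J> \<Longrightarrow> ar T j \<in> \<J>"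
begin

abbreviation (input) "lift_class \<equiv> preimage_class EM em_forgetful"

lemma composites_J_E_Arr: "f \<in> composites C \<J> \<E> \<Longrightarrow> f \<in> Arr C"
  by (auto elim!: composites_E)

lemma T_composites_J_E:
  assumes "f \<in> composites C \<J> \<E>"
  shows "ar T f \<in> composites C \<J> \<E>"
proof -
  obtain e j where e: "e \<in> \<E>" "j \<in> \<J>" "e \<in> Arr C" "j \<in> Arr C" "Cod C e = Dom C j" "f = j \<cdot> e"
    using assms by (rule composites_E)
  have "ar T j \<cdot> ar T e \<in> composites C \<J> \<E>"
    using e by (intro composites_I) (simp_all add: T_E T_J)
  then show ?thesis using e by (simp add: functor_comp)
qed

text \<open>The structure maps on the two intermediate objects of a factorization \<open>f = m j e\<close> are
  the diagonals of the square from \<open>(T e, T j)\<close> to \<open>(j, m)\<close>; the algebra laws hold because both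
  sides are diagonals of one and the same square.\<close>

lemma EM_factorization:
  assumes "((A, h), (B, k), f) \<in> Arr EM"
  obtains X s Y t m j e where "m \<in> \<M>" "j \<in> \<J>" "e \<in> \<E>" "f = m \<cdot> (j \<cdot> e)"
    "((A, h), (X, s), e) \<in> Arr EM" "((X, s), (Y, t), j) \<in> Arr EM" "((Y, t), (B, k), m) \<in> Arr EM"
proof -
  have f: "f \<in> Arr C" "Dom C f = A" "Cod C f = B" and fh: "f \<cdot> h = k \<cdot> ar T f"
    and AB: "(A, h) \<in> Obj EM" "(B, k) \<in> Obj EM"
    using assms by (simp_all add: EM_Arr)
  have h: "A \<in> Obj C" "h \<in> Arr C" "Dom C h = ob T A" "Cod C h = A"
    and h_unit: "h \<cdot> \<eta> A = Ident C A" and h_mult: "h \<cdot> \<mu> A = h \<cdot> ar T h"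
    and k: "B \<in> Obj C" "k \<in> Arr C" "Dom C k = ob T B" "Cod C k = B"
    and k_unit: "k \<cdot> \<eta> B = Ident C B" and k_mult: "k \<cdot> \<mu> B = k \<cdot> ar T k"
    using AB by (simp_all add: EM_Obj)
  obtain m j e where mem: "m \<in> \<M>" "j \<in> \<J>" "e \<in> \<E>"
    and d: "Dom C j = Cod C e" "Dom C m = Cod C j" "Dom C e = Dom C f" "Cod C m = Cod C f"
    and eq: "f = m \<cdot> (j \<cdot> e)"
    using f(1) by (rule factorizationE)
  define X Y where XY: "X = Cod C e" "Y = Cod C j"
  have d: "Dom C e = A" "Cod C e = X" "Dom C j = X" "Cod C j = Y" "Dom C m = Y" "Cod C m = B"
    using d f by (simp_all add: XY)
  have a: "e \<in> Arr C" "j \<in> Arr C" "m \<in> Arr C"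
    using mem E_Arr J_Arr M_Arr by blast+
  have XY_Obj: "X \<in> Obj C" "Y \<in> Obj C" using a XY by simp_all
  \<comment> \<open>The outer sides are dictated by the wish that \<open>e\<close> and
    \<open>m\<close> become algebra morphisms; the square commutes because \<open>f\<close> is
    one.\<close>
  have square: "(k \<cdot> ar T m) \<cdot> (ar T j \<cdot> ar T e) = m \<cdot> (j \<cdot> (e \<cdot> h))"
    using fh a d h k by (simp add: eq functor_comp assoc)
  obtain s t where s: "s \<in> Arr C" "Dom C s = ob T X" "Cod C s = X"
    and t: "t \<in> Arr C" "Dom C t = ob T Y" "Cod C t = Y"
    and se: "s \<cdot> ar T e = e \<cdot> h" and js: "j \<cdot> s = t \<cdot> ar T j" and mt: "m \<cdot> t = k \<cdot> ar T m"
    by (rule lifting_exists [of "ar T e" "ar T j" j m "e \<cdot> h" "k \<cdot> ar T m"])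
      (use mem a d h k square in \<open>auto simp: T_E T_J\<close>)
  note Tcomp = functor_comp [symmetric]
  \<comment> \<open>The multiplication laws involve \<open>ar T s\<close> and \<open>ar T t\<close>,
    so the three relations are also recorded after applying \<open>T\<close>.\<close>
  have Tse: "ar T s \<cdot> ar T (ar T e) = ar T e \<cdot> ar T h"
    using a d s h by (simp add: Tcomp se)
  have Tjs: "ar T j \<cdot> ar T s = ar T t \<cdot> ar T (ar T j)"
    using a d s t by (simp add: Tcomp js)
  have Tmt: "ar T m \<cdot> ar T t = ar T k \<cdot> ar T (ar T m)"
    using a d t k by (simp add: Tcomp mt)
  have ue: "\<eta> X \<cdot> e = ar T e \<cdot> \<eta> A" and uj: "\<eta> Y \<cdot> j = ar T j \<cdot> \<eta> X" and um: "\<eta> B \<cdot> m = ar T m \<cdot> \<eta> Y"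
    using unit_natural a d by metis+
  have me: "ar T e \<cdot> \<mu> A = \<mu> X \<cdot> ar T (ar T e)" and mj: "ar T j \<cdot> \<mu> X = \<mu> Y \<cdot> ar T (ar T j)"
    and mm: "ar T m \<cdot> \<mu> Y = \<mu> B \<cdot> ar T (ar T m)"
    using mult_natural a d by blast+
  \<comment> \<open>These are compared as diagonals of the square from \<open>(e, j)\<close> to
    \<open>(j, m)\<close> with outer sides \<open>e\<close> and \<open>m\<close>, which the pair of
    identities also solves.\<close>
  have "s \<cdot> \<eta> X = Ident C X \<and> t \<cdot> \<eta> Y = Ident C Y"
  proof (rule lifting_unique [of e j j m])
    show "j \<cdot> (s \<cdot> \<eta> X) = (t \<cdot> \<eta> Y) \<cdot> j"
      using a d s t XY_Obj by (simp add: assoc uj reassoc [OF js])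
    have "(s \<cdot> \<eta> X) \<cdot> e = e \<cdot> (h \<cdot> \<eta> A)"
      using a d s h XY_Obj by (simp add: assoc ue reassoc [OF se])
    then show "Ident C X \<cdot> e = (s \<cdot> \<eta> X) \<cdot> e"
      using a d h_unit by simp
    have "m \<cdot> (t \<cdot> \<eta> Y) = (k \<cdot> \<eta> B) \<cdot> m"
      using a d t k XY_Obj by (simp add: assoc um reassoc [OF mt])
    then show "m \<cdot> Ident C Y = m \<cdot> (t \<cdot> \<eta> Y)"
      using a d k_unit by simp
  qed (use mem a d s t XY_Obj in simp_all)
  \<comment> \<open>Here the square starts from \<open>(e, j)\<close> with \<open>T\<close> applied
    twice; the outer sides of the two pairs agree by the multiplication laws of \<open>h\<close> and
    \<open>k\<close>.\<close>
  moreover have "s \<cdot> \<mu> X = s \<cdot> ar T s \<and> t \<cdot> \<mu> Y = t \<cdot> ar T t"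
  proof (rule lifting_unique [of "ar T (ar T e)" "ar T (ar T j)" j m])
    show "j \<cdot> (s \<cdot> \<mu> X) = (t \<cdot> \<mu> Y) \<cdot> ar T (ar T j)"
      using a d s t XY_Obj by (simp add: assoc mj reassoc [OF js])
    show "j \<cdot> (s \<cdot> ar T s) = (t \<cdot> ar T t) \<cdot> ar T (ar T j)"
      using a d s t XY_Obj by (simp add: assoc Tjs reassoc [OF js])
    have "(s \<cdot> \<mu> X) \<cdot> ar T (ar T e) = e \<cdot> (h \<cdot> \<mu> A)"
      using a d s h XY_Obj by (simp add: assoc reassoc [OF se] flip: me)
    also have "\<dots> = (s \<cdot> ar T s) \<cdot> ar T (ar T e)"
      using a d s h XY_Obj by (simp add: assoc h_mult Tse reassoc [OF se])
    finally show "(s \<cdot> ar T s) \<cdot> ar T (ar T e) = (s \<cdot> \<mu> X) \<cdot> ar T (ar T e)" ..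
    have "m \<cdot> (t \<cdot> \<mu> Y) = (k \<cdot> \<mu> B) \<cdot> ar T (ar T m)"
      using a d t k XY_Obj by (simp add: assoc mm reassoc [OF mt])
    also have "\<dots> = m \<cdot> (t \<cdot> ar T t)"
      using a d t k XY_Obj by (simp add: assoc k_mult Tmt reassoc [OF mt])
    finally show "m \<cdot> (t \<cdot> ar T t) = m \<cdot> (t \<cdot> \<mu> Y)" ..
  qed (use mem a d s t XY_Obj in \<open>simp_all add: T_E T_J\<close>)
  ultimately have "(X, s) \<in> Obj EM" "(Y, t) \<in> Obj EM"
    using s t XY_Obj by (simp_all add: EM_Obj)
  then show ?thesis
    using mem eq a d AB se js mt by (intro that [of m j e X s Y t]) (simp_all add: EM_Arr)
qed

section \<open>Diagonals of squares of algebra morphisms\<close>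

lemma EM_ArrD:
  assumes "((X, x), (Y, y), f) \<in> Arr EM"
  shows "f \<in> Arr C" "Dom C f = X" "Cod C f = Y" "f \<cdot> x = y \<cdot> ar T f"
    "X \<in> Obj C" "x \<in> Arr C" "Dom C x = ob T X" "Cod C x = X"
    "Y \<in> Obj C" "y \<in> Arr C" "Dom C y = ob T Y" "Cod C y = Y"
  using assms by (simp_all add: EM_Arr EM_Obj)

text \<open>The diagonal \<open>(s, t)\<close> found in \<open>C\<close> respects the structure maps
  because \<open>(s \<cdot> x2, t \<cdot> x3)\<close> and
  \<open>(y1 \<cdot> ar T s, y2 \<cdot> ar T t)\<close> are diagonals of one square from
  \<open>(ar T e, ar T j)\<close> to \<open>(j', m)\<close>.\<close>

lemma EM_lifting_exists:
  assumes mem: "e \<in> \<E>" "j \<in> \<J>" "j' \<in> \<J>" "m \<in> \<M>"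
    and e: "((X1, x1), (X2, x2), e) \<in> Arr EM" and j: "((X2, x2), (X3, x3), j) \<in> Arr EM"
    and j': "((Y1, y1), (Y2, y2), j') \<in> Arr EM" and m: "((Y2, y2), (Y3, y3), m) \<in> Arr EM"
    and u: "((X1, x1), (Y1, y1), u) \<in> Arr EM" and v: "((X3, x3), (Y3, y3), v) \<in> Arr EM"
    and eq: "v \<cdot> (j \<cdot> e) = m \<cdot> (j' \<cdot> u)"
  obtains s t where "((X2, x2), (Y1, y1), s) \<in> Arr EM" "((X3, x3), (Y2, y2), t) \<in> Arr EM"
    "s \<cdot> e = u" "j' \<cdot> s = t \<cdot> j" "m \<cdot> t = v"
proof -
  note e' = EM_ArrD [OF e] and j1 = EM_ArrD [OF j]
    and j2 = EM_ArrD [OF j'] and m' = EM_ArrD [OF m]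
    and u' = EM_ArrD [OF u] and v' = EM_ArrD [OF v]
  note arr = e'(1-3,5-) j1(1-3,5-) j2(1-3,5-) m'(1-3,5-) u'(1-3,5-) v'(1-3,5-)
  obtain s t where s: "s \<in> Arr C" "Dom C s = X2" "Cod C s = Y1"
    and t: "t \<in> Arr C" "Dom C t = X3" "Cod C t = Y2"
    and se: "s \<cdot> e = u" and js: "j' \<cdot> s = t \<cdot> j" and mt: "m \<cdot> t = v"
    by (rule lifting_exists [of e j j' m u v]) (use mem arr eq in auto)
  note Tcomp = functor_comp [symmetric]
  have Tse: "ar T s \<cdot> ar T e = ar T u" and Tjs: "ar T j' \<cdot> ar T s = ar T t \<cdot> ar T j"
    and Tmt: "ar T m \<cdot> ar T t = ar T v"
    using arr s t by (simp_all add: Tcomp se js mt)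
  have "s \<cdot> x2 = y1 \<cdot> ar T s \<and> t \<cdot> x3 = y2 \<cdot> ar T t"
  proof (rule lifting_unique [of "ar T e" "ar T j" j' m])
    show "j' \<cdot> (s \<cdot> x2) = (t \<cdot> x3) \<cdot> ar T j"
      using arr s t j1(4) by (simp add: assoc reassoc [OF js])
    show "j' \<cdot> (y1 \<cdot> ar T s) = (y2 \<cdot> ar T t) \<cdot> ar T j"
      using arr s t by (simp add: assoc Tjs reassoc [OF j2(4)])
    show "(y1 \<cdot> ar T s) \<cdot> ar T e = (s \<cdot> x2) \<cdot> ar T e"
      using arr s by (simp add: assoc Tse reassoc [OF se] flip: e'(4) u'(4))
    show "m \<cdot> (y2 \<cdot> ar T t) = m \<cdot> (t \<cdot> x3)"
      using arr t by (simp add: assoc Tmt reassoc [OF mt] reassoc [OF m'(4)] v'(4))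
  qed (use mem arr s t in \<open>simp_all add: T_E T_J\<close>)
  then show ?thesis
    using s t e m j j' se js mt by (intro that [of s t]) (simp_all add: EM_Arr)
qed

lemma dfs_EM: "double_factorization_system EM (lift_class \<E>) (lift_class \<J>) (lift_class \<M>)"
proof -
  interpret EM: category EM by (rule category_EM)
  show ?thesis
  proof
    show "lift_class \<E> \<subseteq> Arr EM" "lift_class \<J> \<subseteq> Arr EM" "lift_class \<M> \<subseteq> Arr EM"
      by (auto simp: preimage_class_def)
    show "composites EM (isos EM) (lift_class \<E>) \<subseteq> lift_class \<E>"
    proof
      fix f assume "f \<in> composites EM (isos EM) (lift_class \<E>)"
      then obtain e i where "e \<in> lift_class \<E>" "i \<in> isos EM" "e \<in> Arr EM" "i \<in> Arr EM"
        "Cod EM e = Dom EM i" "f = Comp EM i e"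
        by (rule composites_E)
      then show "f \<in> lift_class \<E>"
        using EM.comp_simps(1) [of e i]
        by (cases e; cases i) (auto simp: preimage_EM isos_EM EM_Arr intro: isos_comp_E)
    qed
    show "composites EM (lift_class \<M>) (isos EM) \<subseteq> lift_class \<M>"
    proof
      fix f assume "f \<in> composites EM (lift_class \<M>) (isos EM)"
      then obtain i m where "i \<in> isos EM" "m \<in> lift_class \<M>" "i \<in> Arr EM" "m \<in> Arr EM"
        "Cod EM i = Dom EM m" "f = Comp EM m i"
        by (rule composites_E)
      then show "f \<in> lift_class \<M>"
        using EM.comp_simps(1) [of i m]
        by (cases m; cases i) (auto simp: preimage_EM isos_EM EM_Arr intro: M_comp_isos)
    qed
    show "composites EM (isos EM) (composites EM (lift_class \<J>) (isos EM)) \<subseteq> lift_class \<J>"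
    proof
      fix f assume "f \<in> composites EM (isos EM) (composites EM (lift_class \<J>) (isos EM))"
      then obtain g i where g: "g \<in> composites EM (lift_class \<J>) (isos EM)"
        and i: "i \<in> isos EM" "g \<in> Arr EM" "i \<in> Arr EM" "Cod EM g = Dom EM i" "f = Comp EM i g"
        by (rule composites_E)
      from g obtain k j where j: "k \<in> isos EM" "j \<in> lift_class \<J>" "k \<in> Arr EM" "j \<in> Arr EM"
        "Cod EM k = Dom EM j" "g = Comp EM j k"
        by (rule composites_E)
      obtain a b c d i' j' k' where "k = (a, b, k')" "j = (b, c, j')" "i = (c, d, i')"
        using i j by (cases i; cases j; cases k) auto
      then show "f \<in> lift_class \<J>"
        using i j EM.comp_simps(1) [of g i]
        by (auto simp: preimage_EM isos_EM EM_Arr intro: isos_comp_J_comp_isos)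
    qed
    show "Arr EM \<subseteq> composites EM (lift_class \<M>) (composites EM (lift_class \<J>) (lift_class \<E>))"
    proof
      fix x assume x: "x \<in> Arr EM"
      obtain A h B k f where x_eq: "x = ((A, h), (B, k), f)" by (metis surj_pair)
      obtain X s Y t m j e where mem: "m \<in> \<M>" "j \<in> \<J>" "e \<in> \<E>" and eq: "f = m \<cdot> (j \<cdot> e)"
        and arr: "((A, h), (X, s), e) \<in> Arr EM" "((X, s), (Y, t), j) \<in> Arr EM"
          "((Y, t), (B, k), m) \<in> Arr EM"
        using x unfolding x_eq by (rule EM_factorization)
      have je: "Comp EM ((X, s), (Y, t), j) ((A, h), (X, s), e)
          \<in> composites EM (lift_class \<J>) (lift_class \<E>)"
        using mem arr by (intro composites_I) (simp_all add: preimage_EM)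
      have "Comp EM ((Y, t), (B, k), m) (Comp EM ((X, s), (Y, t), j) ((A, h), (X, s), e))
          \<in> composites EM (lift_class \<M>) (composites EM (lift_class \<J>) (lift_class \<E>))"
        using mem arr EM.comp_simps(1) [OF arr(1,2)]
        by (intro composites_I je) (simp_all add: preimage_EM)
      then show "x \<in> composites EM (lift_class \<M>) (composites EM (lift_class \<J>) (lift_class \<E>))"
        by (simp add: x_eq eq)
    qed
  next
    fix e j j' m u v a1 a2 a3 b1 b2 b3
    assume "e \<in> lift_class \<E> \<inter> hom EM a1 a2" "j \<in> lift_class \<J> \<inter> hom EM a2 a3"
      "j' \<in> lift_class \<J> \<inter> hom EM b1 b2" "m \<in> lift_class \<M> \<inter> hom EM b2 b3"
      "u \<in> hom EM a1 b1" "v \<in> hom EM a3 b3"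
      and sq: "Comp EM v (Comp EM j e) = Comp EM m (Comp EM j' u)"
    moreover obtain X1 x1 X2 x2 X3 x3 where a: "a1 = (X1, x1)" "a2 = (X2, x2)" "a3 = (X3, x3)"
      by (metis surj_pair)
    moreover obtain Y1 y1 Y2 y2 Y3 y3 where b: "b1 = (Y1, y1)" "b2 = (Y2, y2)" "b3 = (Y3, y3)"
      by (metis surj_pair)
    ultimately obtain e0 j0 j1 m0 u0 v0 where mem: "e0 \<in> \<E>" "j0 \<in> \<J>" "j1 \<in> \<J>" "m0 \<in> \<M>"
      and e: "((X1, x1), (X2, x2), e0) \<in> Arr EM" and j: "((X2, x2), (X3, x3), j0) \<in> Arr EM"
      and j': "((Y1, y1), (Y2, y2), j1) \<in> Arr EM" and m: "((Y2, y2), (Y3, y3), m0) \<in> Arr EM"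
      and u: "((X1, x1), (Y1, y1), u0) \<in> Arr EM" and v: "((X3, x3), (Y3, y3), v0) \<in> Arr EM"
      and eqs: "e = (a1, a2, e0)" "j = (a2, a3, j0)" "j' = (b1, b2, j1)" "m = (b2, b3, m0)"
        "u = (a1, b1, u0)" "v = (a3, b3, v0)"
      by (auto simp: EM_hom preimage_EM)
    have sq': "v0 \<cdot> (j0 \<cdot> e0) = m0 \<cdot> (j1 \<cdot> u0)"
      using sq by (simp add: eqs)
    obtain s t where s: "((X2, x2), (Y1, y1), s) \<in> Arr EM" and t: "((X3, x3), (Y2, y2), t) \<in> Arr EM"
      and st: "s \<cdot> e0 = u0" "j1 \<cdot> s = t \<cdot> j0" "m0 \<cdot> t = v0"
      by (rule EM_lifting_exists [OF mem e j j' m u v sq'])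
    show "\<exists>!(s, t). s \<in> hom EM a2 b1 \<and> t \<in> hom EM a3 b2 \<and>
      Comp EM s e = u \<and> Comp EM j' s = Comp EM t j \<and> Comp EM m t = v"
    proof (rule ex1I [of _ "((a2, b1, s), (a3, b2, t))"])
      show "case ((a2, b1, s), (a3, b2, t)) of (s, t) \<Rightarrow> s \<in> hom EM a2 b1 \<and> t \<in> hom EM a3 b2 \<and>
        Comp EM s e = u \<and> Comp EM j' s = Comp EM t j \<and> Comp EM m t = v"
        using s t st by (simp add: EM_hom eqs a b)
    next
      fix p
      assume "case p of (s, t) \<Rightarrow> s \<in> hom EM a2 b1 \<and> t \<in> hom EM a3 b2 \<and>
        Comp EM s e = u \<and> Comp EM j' s = Comp EM t j \<and> Comp EM m t = v"
      then obtain s' t' where p: "p = ((a2, b1, s'), (a3, b2, t'))"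
        and s': "((X2, x2), (Y1, y1), s') \<in> Arr EM" and t': "((X3, x3), (Y2, y2), t') \<in> Arr EM"
        and st': "s' \<cdot> e0 = u0" "j1 \<cdot> s' = t' \<cdot> j0" "m0 \<cdot> t' = v0"
        by (cases p) (auto simp: EM_hom eqs a b)
      \<comment> \<open>The forgetful functor is faithful, so uniqueness of the diagonal in
        \<open>C\<close> suffices.\<close>
      have "s = s' \<and> t = t'"
        using mem st st' e j j' m s t s' t'
        by (intro lifting_unique [of e0 j0 j1 m0]) (simp_all add: EM_Arr)
      then show "p = ((a2, b1, s), (a3, b2, t))" by (simp add: p)
    qed
  qed
qed

section \<open>Fibrations of algebras\<close>

text \<open>The filler of the square from \<open>e\<close> to \<open>g \<cdot> e\<close> with sides
  the identity and \<open>g\<close> is a left inverse of \<open>e\<close>; uniqueness of fillers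
  from \<open>e\<close> to \<open>g\<close> makes it two-sided.\<close>

lemma E_factor_of_MJ_iso:
  assumes e: "e \<in> \<E>" and g: "g \<in> composites C \<M> \<J>" "Dom C g = Cod C e"
    and f: "g \<cdot> e \<in> composites C \<M> \<J>"
  shows "e \<in> isos C"
proof -
  have a: "e \<in> Arr C" "g \<in> Arr C" using E_Arr [OF e] g by (auto elim!: composites_E)
  have "\<exists>!d. d \<in> hom C (Cod C e) (Dom C (g \<cdot> e)) \<and> d \<cdot> e = Ident C (Dom C e) \<and> (g \<cdot> e) \<cdot> d = g"
    using orthogonal_E_MJ [OF e f] a g by (intro orthogonalD) simp_all
  then obtain d where d: "d \<in> Arr C" "Dom C d = Cod C e" "Cod C d = Dom C e"
    "d \<cdot> e = Ident C (Dom C e)" "(g \<cdot> e) \<cdot> d = g"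
    using a g by (auto simp: hom_iff)
  have "\<exists>!y. y \<in> hom C (Cod C e) (Dom C g) \<and> y \<cdot> e = e \<and> g \<cdot> y = g"
    using orthogonal_E_MJ [OF e g(1)] a g by (intro orthogonalD) simp_all
  moreover have "e \<cdot> d \<in> hom C (Cod C e) (Dom C g)" "(e \<cdot> d) \<cdot> e = e" "g \<cdot> (e \<cdot> d) = g"
    "Ident C (Cod C e) \<in> hom C (Cod C e) (Dom C g)" "Ident C (Cod C e) \<cdot> e = e"
    "g \<cdot> Ident C (Cod C e) = g"
    using a d g by (simp_all add: hom_iff assoc)
  ultimately have "e \<cdot> d = Ident C (Cod C e)" by blast
  then show ?thesis using a d by (intro isosI [of e d]) simp_all
qed

text \<open>An algebra morphism \<open>f\<close> lying over \<open>\<M> \<cdot> \<J>\<close> factors as \<open>m j e\<close> in algebras; by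
  orthogonality in \<open>C\<close> its component \<open>e\<close> is invertible, and so can be absorbed into \<open>j\<close>.\<close>

lemma composites_lift_class:
  "composites EM (lift_class \<M>) (lift_class \<J>) = lift_class (composites C \<M> \<J>)"
proof
  interpret EM: category EM by (rule category_EM)
  show "composites EM (lift_class \<M>) (lift_class \<J>) \<subseteq> lift_class (composites C \<M> \<J>)"
  proof
    fix f assume "f \<in> composites EM (lift_class \<M>) (lift_class \<J>)"
    then obtain j m where "j \<in> lift_class \<J>" "m \<in> lift_class \<M>" "j \<in> Arr EM" "m \<in> Arr EM"
      "Cod EM j = Dom EM m" "f = Comp EM m j"
      by (rule composites_E)
    then show "f \<in> lift_class (composites C \<M> \<J>)"
      using EM.comp_simps(1) [of j m]
      by (cases j; cases m) (auto simp: preimage_EM EM_Arr intro: composites_I)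
  qed
  show "lift_class (composites C \<M> \<J>) \<subseteq> composites EM (lift_class \<M>) (lift_class \<J>)"
  proof
    fix x assume x: "x \<in> lift_class (composites C \<M> \<J>)"
    obtain A h B k f where x_eq: "x = ((A, h), (B, k), f)" by (metis surj_pair)
    have f: "((A, h), (B, k), f) \<in> Arr EM" "f \<in> composites C \<M> \<J>"
      using x by (simp_all add: x_eq preimage_EM)
    obtain X s Y t m j e where mem: "m \<in> \<M>" "j \<in> \<J>" "e \<in> \<E>" and eq: "f = m \<cdot> (j \<cdot> e)"
      and arr: "((A, h), (X, s), e) \<in> Arr EM" "((X, s), (Y, t), j) \<in> Arr EM"
        "((Y, t), (B, k), m) \<in> Arr EM"
      using f(1) by (rule EM_factorization)
    note a = EM_ArrD [OF arr(1)] EM_ArrD [OF arr(2)]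
      EM_ArrD [OF arr(3)]
    have "m \<cdot> j \<in> composites C \<M> \<J>"
      using mem a by (intro composites_I) simp_all
    then have iso: "e \<in> isos C"
      using mem f(2) a by (intro E_factor_of_MJ_iso [of e "m \<cdot> j"]) (simp_all add: eq assoc)
    \<comment> \<open>The identity serves as the left isomorphism, since the closure axiom for
      \<open>\<J>\<close> composes with isomorphisms on both sides.\<close>
    have "Ident C Y \<cdot> (j \<cdot> e) \<in> \<J>"
      using iso mem a by (intro isos_comp_J_comp_isos ident_isos) simp_all
    then have "j \<cdot> e \<in> \<J>" using a by simp
    moreover have je: "((A, h), (Y, t), j \<cdot> e) \<in> Arr EM"
      using EM.comp_simps(1) [OF arr(1,2)] by simp
    ultimately have "Comp EM ((Y, t), (B, k), m) ((A, h), (Y, t), j \<cdot> e)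
        \<in> composites EM (lift_class \<M>) (lift_class \<J>)"
      using mem arr by (intro composites_I) (simp_all add: preimage_EM)
    then show "x \<in> composites EM (lift_class \<M>) (lift_class \<J>)"
      by (simp add: x_eq eq)
  qed
qed

section \<open>The right-induced system and the Quillen adjunction\<close>

text \<open>Applied to algebras, \<open>E_eq_left_orthogonal\<close> gives the left orthogonal of
  the composites of lifted classes, and \<open>composites_lift_class\<close> turns these into the
  preimage of the fibrations.\<close>

lemma right_induced_EM:
  "right_induced_dfs C EM (em_free C T \<mu>) em_forgetful \<eta> (em_counit T \<mu>) (\<E>, \<J>, \<M>)
    (lift_class \<E>, lift_class \<J>, lift_class \<M>)"
  using double_factorization_system.E_eq_left_orthogonal [OF dfs_EM] dfs_EM
  by (simp add: right_induced_dfs_def adjunction_EM composites_lift_class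
      double_factorization_system_axioms)

text \<open>The free morphism on \<open>f\<close> has underlying arrow \<open>ar T f\<close>, so
  both inclusions come from stability of \<open>\<E>\<close> and \<open>\<J>\<close> under
  \<open>T\<close>; cofibrations are treated factor by factor.\<close>

lemma quillen_EM:
  "quillen_adjunction C EM (em_free C T \<mu>) em_forgetful \<eta> (em_counit T \<mu>) (\<E>, \<J>, \<M>)
    (lift_class \<E>, lift_class \<J>, lift_class \<M>)"
proof -
  interpret F: adjunction C EM "em_free C T \<mu>" em_forgetful \<eta> "em_counit T \<mu>"
    by (rule adjunction_EM)
  have free: "ar (em_free C T \<mu>) f \<in> lift_class \<A>" if "ar T f \<in> \<A>" "f \<in> Arr C" for f \<A>
    using that by (simp add: em_free_def preimage_EM free_morphism)
  have "ar (em_free C T \<mu>) f \<in> composites EM (lift_class \<J>) (lift_class \<E>)"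
    if f: "f \<in> composites C \<J> \<E>" for f
  proof -
    obtain e j where e: "e \<in> \<E>" "j \<in> \<J>" "e \<in> Arr C" "j \<in> Arr C" "Cod C e = Dom C j" "f = j \<cdot> e"
      using f by (rule composites_E)
    have "Comp EM (ar (em_free C T \<mu>) j) (ar (em_free C T \<mu>) e)
        \<in> composites EM (lift_class \<J>) (lift_class \<E>)"
      using e by (intro composites_I free) (simp_all add: T_E T_J)
    then show ?thesis using e by (simp add: F.left.functor_comp)
  qed
  then show ?thesis
    by (auto simp: quillen_adjunction_def adjunction_EM dfs_EM double_factorization_system_axioms
        intro!: free T_E E_Arr)
qed

end

theorem proposition1:
  fixes C :: "('o, 'm) category"
    and T :: "('o, 'm, 'o, 'm) fctr"
    and \<eta> \<mu> :: "'o \<Rightarrow> 'm"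
    and \<E> \<J> \<M> \<S> :: "'m set"
  assumes dfs: "double_factorization_system C \<E> \<J> \<M>"
    and monad: "monad C T \<eta> \<mu>"
    and bicomplete_cocontinuous:
      "(bicomplete TYPE('u) C \<and> preserves_small_colimits TYPE('u) C C T) \<or>
       (finitely_bicomplete C \<and> preserves_finite_colimits C C T)"
    and T_E: "ar T ` \<E> \<subseteq> \<E>"
    and T_J: "ar T ` \<J> \<subseteq> \<J>"
    and S: "\<S> = \<J> \<or> \<S> = composites C \<J> \<E>"
  shows "let CT = em_category C T \<eta> \<mu>;
             F = em_free C T \<mu>;
             V = em_forgetful;
             \<epsilon> = em_counit T \<mu>;
             ET = preimage_class CT V \<E>;
             JT = preimage_class CT V \<J>;
             MT = preimage_class CT V \<M>;
             ST = preimage_class CT V \<S>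
         in right_induced_dfs C CT F V \<eta> \<epsilon> (\<E>, \<J>, \<M>) (ET, JT, MT) \<and>
            (\<forall>(A, h) \<in> Obj CT. local_object CT ST (A, h) \<longleftrightarrow> local_object C \<S> A) \<and>
            quillen_adjunction C CT F V \<eta> \<epsilon> (\<E>, \<J>, \<M>) (ET, JT, MT)"
proof -
  interpret monad_preserving_dfs C \<E> \<J> \<M> T \<eta> \<mu>
    using dfs monad T_E T_J
    by (auto simp: monad_preserving_dfs_def monad_preserving_dfs_axioms_def)
  have "\<S> \<subseteq> Arr C"
    using S J_subset composites_J_E_Arr by blast
  moreover have "\<And>f. f \<in> \<S> \<Longrightarrow> ar T f \<in> \<S>"
    using S T_J T_composites_J_E by blast
  ultimately show ?thesis
    unfolding Let_def
    using right_induced_EM quillen_EM local_object_EM_iff by blast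
qed

end
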